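(* Let $d\ge 2$, let $\mathcal{A}\subset\mathbb{R}^d$ be the affine hyperplane $x_1+\cdots+x_d=1$ and let $\Delta\subset\mathcal{A}$ be the open simplex defined by $x_1>0,\ldots,x_d>0$. Let $L\subset\mathcal{A}$ be an affine subspace intersecting $\Delta$ with $\dim L=d-k-1$, where $k\ge 1$. Suppose the maximum of $f(x)=\sum_{i=1}^d\ln x_i$ on $\Delta\cap L$ is attained at $a=(\alpha_1,\ldots,\alpha_d)$. (1) We have $$\frac{\operatorname{vol}_{d-k-1}(\Delta\cap L)}{\operatorname{vol}(\Delta)}\ \ge\ \gamma\,\frac{1}{d^2\omega_k}\,d^d e^{f(a)},$$ where $\omega_k=\pi^{k/2}/\Gamma(k/2+1)$ is the volume of the $k$-dimensional unit ball and $\gamma>0$ is an absolute constant (one can choose $\gamma=1/(2e^3)$). (2) Suppose that $\alpha_i\ge\epsilon/d$ for some $\epsilon>0$ and all $i=1,\ldots,d$. Then $$\frac{\operatorname{vol}_{d-k-1}(\Delta\cap L)}{\operatorname{vol}(\Delta)}\ \le\ \gamma\Big(\frac{d^2}{2\epsilon}\Big)^k d^d e^{f(a)},$$ where $\gamma>0$ is an absolute constant (one can choose $\gamma=2e$).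
   Context: Volumes are taken with respect to the Euclidean structure on $\mathcal{A}$ (and its affine subspaces) induced from $\mathbb{R}^d$: $\operatorname{vol}_s$ is $s$-dimensional volume and $\operatorname{vol}=\operatorname{vol}_{d-1}$, so that $\operatorname{vol}(\Delta)=\sqrt{d}/(d-1)!$. *)

theory Defs
  imports "HOL-Analysis.Analysis"
begin

definition simplex_hyperplane :: "(real ^ 'n) set" where
  "simplex_hyperplane = {x. (\<Sum>i\<in>UNIV. x $ i) = 1}"

definition open_simplex :: "(real ^ 'n) set" where
  "open_simplex = {x \<in> simplex_hyperplane. \<forall>i. x $ i > 0}"

definition log_sum :: "real ^ 'n \<Rightarrow> real" where
  "log_sum x = (\<Sum>i\<in>UNIV. ln (x $ i))"

definition orthonormal_frame :: "nat \<Rightarrow> (nat \<Rightarrow> 'a::euclidean_space) \<Rightarrow> bool" where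
  "orthonormal_frame s b \<longleftrightarrow> (\<forall>i<s. \<forall>j<s. b i \<bullet> b j = (if i = j then 1 else 0))"

text \<open>Only the coordinates \<open>x 0, \<dots>, x (s - 1)\<close> matter; if \<open>b\<close> is orthonormal, this is an isometry
  of Euclidean \<open>s\<close>-space onto the \<open>s\<close>-dimensional affine subspace through \<open>p\<close> spanned by the \<open>b i\<close>.\<close>

definition frame_map ::
  "nat \<Rightarrow> 'a::euclidean_space \<Rightarrow> (nat \<Rightarrow> 'a) \<Rightarrow> (nat \<Rightarrow> real) \<Rightarrow> 'a" where
  "frame_map s p b x = p + (\<Sum>i<s. x i *\<^sub>R b i)"

definition frame_vol ::
  "nat \<Rightarrow> 'a::euclidean_space \<Rightarrow> (nat \<Rightarrow> 'a) \<Rightarrow> 'a set \<Rightarrow> real" where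
  "frame_vol s p b S =
     measure (Pi\<^sub>M {..<s} (\<lambda>_. lborel))
       {x \<in> space (Pi\<^sub>M {..<s} (\<lambda>_. lborel)). frame_map s p b x \<in> S}"

text \<open>The \<open>s\<close>-dimensional volume of a bounded Borel set \<open>S\<close> contained in some \<open>s\<close>-dimensional
  affine subspace: Lebesgue measure in orthonormal coordinates on such a subspace. The value does
  not depend on the chosen frame, since Lebesgue measure on Euclidean \<open>s\<close>-space is invariant
  under isometries (and \<open>S\<close> is a null set if it lies in two different such subspaces).
  For \<open>s = 0\<close> a point has volume 1.\<close>

definition vol :: "nat \<Rightarrow> 'a::euclidean_space set \<Rightarrow> real" where
  "vol s S =
     (let (p, b) = (SOME (p, b). orthonormal_frame s b \<and> S \<subseteq> range (frame_map s p b))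
      in frame_vol s p b S)"

end

theory Submission
  imports Defs "HOL-Probability.Distributions"
begin

text \<open>
  Let \<open>V p\<close> be the \<open>s\<close>-dimensional volume of the section of the positive orthant by the translate of
  \<open>L\<close> through \<open>p\<close>, where \<open>s = d - k - 1\<close>, and let \<open>\<sigma>\<close> be the sum of the coordinates.

  Lower bound: \<open>V\<close> is log-concave by the Prekopa-Leindler inequality, hence so is \<open>V \<sigma>^k e^\<sigma>\<close>. A
  supergradient \<open>u\<close> of its logarithm at \<open>a\<close> has all coordinates at least \<open>1\<close> and is orthogonal to the
  directions of \<open>L\<close>. Integrating \<open>exp (- u \<bullet> x)\<close> over the orthant gives \<open>1 / \<Prod> u_i\<close>, while slicing along
  \<open>L\<close> bounds the same integral by \<open>V a * exp (1 - u \<bullet> a) * \<omega>_k / sqrt d\<close>, because at height \<open>\<sigma>\<close> the base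
  of the slicing lies in a \<open>k\<close>-ball of radius \<open>\<sigma>\<close>. Finally \<open>t \<le> exp (t - 1)\<close> is applied to all \<open>t = u_i * a_i\<close>.

  Upper bound: as \<open>a\<close> is a critical point of \<open>f\<close> on \<open>L\<close>, the functional \<open>u = (1 / a_i)\<close> is constant on \<open>L\<close>.
  The integral of \<open>exp (- u \<bullet> x)\<close> over sections of the orthant is compared under the successive addition
  of the directions \<open>a\<close> and then \<open>k\<close> coordinate vectors, each time a coordinate vector far from the
  current subspace; the last integral, over the whole orthant, is \<open>\<Prod> a_i\<close>.
\<close>

section \<open>Integrals over affine sections\<close>

text \<open>For orthonormal \<open>b\<close> this is the integral of \<open>F\<close> over the
  affine subspace through \<open>p\<close> in the directions \<open>b 0\<close>, ...,
  \<open>b (m - 1)\<close>. With values in \<open>ennreal\<close>, Tonelli applies without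
  integrability conditions.\<close>

definition slice_integral ::
  "nat \<Rightarrow> (nat \<Rightarrow> 'a::euclidean_space) \<Rightarrow> ('a \<Rightarrow> ennreal) \<Rightarrow> 'a \<Rightarrow> ennreal" where
  "slice_integral m b F p = (\<integral>\<^sup>+ y. F (frame_map m p b y) \<partial>Pi\<^sub>M {..<m} (\<lambda>_. lborel))"

lemma frame_map_measurable [measurable]:
  "(\<lambda>y. frame_map m p b y) \<in> borel_measurable (Pi\<^sub>M {..<m} (\<lambda>_. lborel))"
  unfolding frame_map_def by measurable

lemma slice_integral_measurable [measurable]:
  assumes [measurable]: "F \<in> borel_measurable borel"
  shows "slice_integral m b F \<in> borel_measurable borel"
proof -
  interpret product_sigma_finite "\<lambda>_. lborel :: real measure" ..
  interpret sigma_finite_measure "Pi\<^sub>M {..<m} (\<lambda>_. lborel :: real measure)"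
    by (rule sigma_finite) simp
  have [measurable]: "case_prod (\<lambda>p y. F (frame_map m p b y))
      \<in> borel_measurable (borel \<Otimes>\<^sub>M Pi\<^sub>M {..<m} (\<lambda>_. lborel))"
    unfolding frame_map_def by measurable
  have "(\<lambda>p. \<integral>\<^sup>+ y. F (frame_map m p b y) \<partial>Pi\<^sub>M {..<m} (\<lambda>_. lborel)) \<in> borel_measurable borel"
    by measurable
  then show ?thesis by (simp add: slice_integral_def [abs_def])
qed

lemma slice_integral_0 [simp]: "slice_integral 0 b F p = F p"
  by (simp add: slice_integral_def PiM_empty frame_map_def nn_integral_count_space_finite)

text \<open>Tonelli with the last frame vector as the outer variable; the inductions on
  \<open>m\<close> peel off directions in this order.\<close>

lemma slice_integral_Suc:
  assumes [measurable]: "F \<in> borel_measurable borel"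
  shows "slice_integral (Suc m) b F p = (\<integral>\<^sup>+ t. slice_integral m b F (p + t *\<^sub>R b m) \<partial>lborel)"
proof -
  interpret product_sigma_finite "\<lambda>_. lborel :: real measure" ..
  have *: "frame_map (Suc m) p b (x(m := t)) = frame_map m (p + t *\<^sub>R b m) b x" for x t
    by (simp add: frame_map_def)
  have [measurable]: "(\<lambda>y. F (frame_map (Suc m) p b y))
      \<in> borel_measurable (Pi\<^sub>M (insert m {..<m}) (\<lambda>_. lborel))"
    unfolding lessThan_Suc [symmetric] by measurable
  have "slice_integral (Suc m) b F p
      = (\<integral>\<^sup>+ t. (\<integral>\<^sup>+ x. F (frame_map (Suc m) p b (x(m := t))) \<partial>Pi\<^sub>M {..<m} (\<lambda>_. lborel)) \<partial>lborel)"
    unfolding slice_integral_def lessThan_Suc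
    by (rule product_nn_integral_insert_rev) auto
  then show ?thesis by (simp add: * slice_integral_def)
qed

lemma slice_integral_add:
  assumes [measurable]: "F \<in> borel_measurable borel"
  shows "slice_integral (m + n) b F p
    = slice_integral n (\<lambda>i. b (m + i)) (slice_integral m b F) p"
  by (induction n arbitrary: p) (simp_all add: slice_integral_Suc)

lemma slice_integral_cong:
  assumes "\<And>i. i < m \<Longrightarrow> b i = c i"
  shows "slice_integral m b F p = slice_integral m c F p"
  using assms by (simp add: slice_integral_def frame_map_def)

lemma slice_integral_mono:
  assumes "\<And>x. F x \<le> G x"
  shows "slice_integral m b F p \<le> slice_integral m b G p"
  using assms by (auto simp: slice_integral_def intro!: nn_integral_mono)

text \<open>For a shift along a single \<open>b j\<close>, either \<open>b j\<close> is the
  outermost direction and one-dimensional translation invariance applies, or the shift passes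
  through to the inner integral. Linear combinations follow by span induction.\<close>

lemma slice_integral_translate:
  assumes [measurable]: "F \<in> borel_measurable borel" and "q \<in> span (b ` {..<m})"
  shows "slice_integral m b F (p + q) = slice_integral m b F p"
proof -
  have basic: "slice_integral m b F (p + c *\<^sub>R b j) = slice_integral m b F p" if "j < m" for c j p
    using that
  proof (induction m arbitrary: p)
    case (Suc m)
    show ?case
    proof (cases "j = m")
      case True
      have "(\<integral>\<^sup>+ t. slice_integral m b F (p + t *\<^sub>R b m) \<partial>lborel)
          = (\<integral>\<^sup>+ t. slice_integral m b F (p + (c + 1 * t) *\<^sub>R b m) \<partial>lborel)"
        by (subst nn_integral_real_affine [where c = 1 and t = c]) auto
      then show ?thesis
        using True by (simp add: slice_integral_Suc algebra_simps)
    next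
      case False
      then have "slice_integral m b F (p + c *\<^sub>R b j + t *\<^sub>R b m)
          = slice_integral m b F (p + t *\<^sub>R b m)" for t
        using Suc.IH [of "p + t *\<^sub>R b m"] Suc.prems by (simp add: algebra_simps)
      then show ?thesis by (simp add: slice_integral_Suc)
    qed
  qed simp
  show ?thesis
    using assms(2)
  proof (induction arbitrary: p rule: span_induct_alt)
    case (step c x y)
    then obtain j where "j < m" "x = b j" by auto
    then show ?case
      using step.IH [of "p + c *\<^sub>R b j"] basic [of j p c] by (simp add: algebra_simps)
  qed simp
qed

text \<open>Substituting \<open>c * t\<close> in each of the \<open>m\<close> coordinates produces
  one factor \<open>c\<close> apiece, and \<open>F\<close> absorbs the dilation.\<close>

lemma slice_integral_scale:
  assumes [measurable]: "F \<in> borel_measurable borel"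
    and F: "\<And>x. F (c *\<^sub>R x) = F x" and "c > 0"
  shows "slice_integral m b F (c *\<^sub>R p) = ennreal (c ^ m) * slice_integral m b F p"
proof (induction m arbitrary: p)
  case (Suc m)
  have "slice_integral (Suc m) b F (c *\<^sub>R p)
      = ennreal c * (\<integral>\<^sup>+ t. slice_integral m b F (c *\<^sub>R p + (0 + c * t) *\<^sub>R b m) \<partial>lborel)"
    using \<open>c > 0\<close>
    by (subst slice_integral_Suc, simp, subst nn_integral_real_affine [where c = c and t = 0]) auto
  also have "\<dots> = ennreal c * (\<integral>\<^sup>+ t. ennreal (c ^ m) * slice_integral m b F (p + t *\<^sub>R b m) \<partial>lborel)"
    by (simp add: Suc.IH [symmetric] algebra_simps)
  also have "\<dots> = ennreal (c ^ Suc m) * slice_integral (Suc m) b F p"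
    using \<open>c > 0\<close> by (simp add: nn_integral_cmult slice_integral_Suc ennreal_mult' mult_ac)
  finally show ?case .
qed (simp add: F)

lemma frame_vol_eq_slice_integral:
  assumes [measurable]: "S \<in> sets borel"
  shows "frame_vol m p b S = enn2real (slice_integral m b (indicator S) p)"
proof -
  have "slice_integral m b (indicator S) p =
      (\<integral>\<^sup>+ y. indicator {x \<in> space (Pi\<^sub>M {..<m} (\<lambda>_. lborel)). frame_map m p b x \<in> S} y
        \<partial>Pi\<^sub>M {..<m} (\<lambda>_. lborel))"
    unfolding slice_integral_def by (intro nn_integral_cong) (auto simp: indicator_def)
  also have "\<dots> = emeasure (Pi\<^sub>M {..<m} (\<lambda>_. lborel))
      {x \<in> space (Pi\<^sub>M {..<m} (\<lambda>_. lborel)). frame_map m p b x \<in> S}"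
    by (rule nn_integral_indicator) measurable
  finally show ?thesis by (simp add: frame_vol_def measure_def)
qed

section \<open>Orthonormal frames: norms, balls and spans\<close>

lemma norm_frame_map_0:
  assumes "orthonormal_frame m b"
  shows "norm (frame_map m 0 b y) = sqrt (\<Sum>i<m. (y i)\<^sup>2)"
proof -
  have "frame_map m 0 b y \<bullet> frame_map m 0 b y
      = (\<Sum>i<m. \<Sum>j<m. y i * (y j * (b i \<bullet> b j)))"
    by (simp add: frame_map_def inner_sum_left inner_sum_right sum_distrib_left)
       (subst sum.swap, simp add: mult_ac inner_commute)
  also have "\<dots> = (\<Sum>i<m. \<Sum>j<m. if i = j then y i * y j else 0)"
    using assms by (intro sum.cong refl) (auto simp: orthonormal_frame_def)
  also have "\<dots> = (\<Sum>i<m. (y i)\<^sup>2)"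
    by (simp add: power2_eq_square)
  finally show ?thesis by (simp add: norm_eq_sqrt_inner)
qed

lemma slice_integral_indicator_cball:
  assumes "orthonormal_frame m b" "r > 0"
  shows "slice_integral m b (indicator (cball 0 r)) 0 = ennreal (unit_ball_vol (real m) * r ^ m)"
proof -
  let ?M = "Pi\<^sub>M {..<m} (\<lambda>_. lborel :: real measure)"
  have "slice_integral m b (indicator (cball 0 r)) 0
      = (\<integral>\<^sup>+ y. indicator ({f. sqrt (\<Sum>i\<in>{..<m}. (f i)\<^sup>2) \<le> r} \<inter> space ?M) y \<partial>?M)"
    unfolding slice_integral_def
    by (intro nn_integral_cong) (auto simp: indicator_def norm_frame_map_0 [OF assms(1)])
  also have "\<dots> = emeasure ?M ({f. sqrt (\<Sum>i\<in>{..<m}. (f i)\<^sup>2) \<le> r} \<inter> space ?M)"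
    by (rule nn_integral_indicator) measurable
  finally show ?thesis using emeasure_cball_aux [of "{..<m}" r] assms(2) by simp
qed

lemma span_orthonormal_frame:
  assumes "orthonormal_frame m (b :: nat \<Rightarrow> 'a::euclidean_space)"
  shows "independent (b ` {..<m})" "inj_on b {..<m}" "dim (span (b ` {..<m})) = m"
proof -
  have ortho: "pairwise orthogonal (b ` {..<m})"
    using assms by (auto simp: pairwise_def orthogonal_def orthonormal_frame_def)
  have "0 \<notin> b ` {..<m}"
    using assms by (force simp: orthonormal_frame_def)
  with ortho show ind: "independent (b ` {..<m})" by (rule pairwise_orthogonal_independent)
  show inj: "inj_on b {..<m}"
  proof
    fix i j assume "i \<in> {..<m}" "j \<in> {..<m}" "b i = b j"
    then show "i = j" using assms unfolding orthonormal_frame_def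
      by (metis lessThan_iff zero_neq_one)
  qed
  show "dim (span (b ` {..<m})) = m"
    using ind inj by (simp add: dim_eq_card_independent card_image)
qed

lemma span_full_orthonormal_frame:
  assumes "orthonormal_frame DIM('a) (b :: nat \<Rightarrow> 'a::euclidean_space)"
  shows "span (b ` {..<DIM('a)}) = UNIV"
  using span_orthonormal_frame [OF assms] by (simp add: dim_eq_full)

text \<open>Both sides are translation invariant, and integrating \<open>F x * G (x + y)\<close> in both orders
  shows that two translation invariant measures agree up to a factor, which is \<open>1\<close> because they
  agree on the unit ball.\<close>

lemma slice_integral_full:
  fixes F :: "'a::euclidean_space \<Rightarrow> ennreal"
  assumes [measurable]: "F \<in> borel_measurable borel"
    and b: "orthonormal_frame DIM('a) b"
  shows "slice_integral DIM('a) b F p = (\<integral>\<^sup>+ x. F x \<partial>lborel)"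
proof -
  let ?d = "DIM('a)" and ?M = "Pi\<^sub>M {..<DIM('a)} (\<lambda>_. lborel :: real measure)"
  let ?G = "indicator (cball 0 1) :: 'a \<Rightarrow> ennreal"
  interpret product_sigma_finite "\<lambda>_. lborel :: real measure" ..
  interpret M: sigma_finite_measure ?M
    by (rule sigma_finite) simp
  interpret L: sigma_finite_measure "lborel :: 'a measure" ..
  interpret pair_sigma_finite ?M "lborel :: 'a measure" ..
  have transl: "slice_integral ?d b H q = slice_integral ?d b H 0"
    if "H \<in> borel_measurable borel" for q and H :: "'a \<Rightarrow> ennreal"
    using slice_integral_translate [OF that, of q b ?d 0] span_full_orthonormal_frame [OF b] by simp
  have lb: "(\<integral>\<^sup>+ x. H (c + x) \<partial>lborel) = (\<integral>\<^sup>+ x. H x \<partial>lborel)"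
    if [measurable]: "H \<in> borel_measurable borel" for c and H :: "'a \<Rightarrow> ennreal"
    by (subst (2) lborel_distr_plus [of c, symmetric]) (subst nn_integral_distr; simp)
  have [measurable, simp]: "?G \<in> borel_measurable borel"
    by (rule borel_measurable_indicator) simp
  have G1: "(\<integral>\<^sup>+ x. ?G x \<partial>lborel) = ennreal (unit_ball_vol (real ?d))"
    by (simp add: emeasure_cball)
  have G2: "slice_integral ?d b ?G q = ennreal (unit_ball_vol (real ?d))" for q
    using slice_integral_indicator_cball [OF b, of 1]
    by (subst transl) auto
  have "slice_integral ?d b F 0 * ennreal (unit_ball_vol (real ?d))
      = (\<integral>\<^sup>+ y. F (frame_map ?d 0 b y) * (\<integral>\<^sup>+ x. ?G (- (frame_map ?d 0 b y) + x) \<partial>lborel) \<partial>?M)"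
    unfolding slice_integral_def G1 [symmetric]
    by (subst nn_integral_multc [symmetric], measurable, subst lb, simp_all)
  also have "\<dots> = (\<integral>\<^sup>+ y. (\<integral>\<^sup>+ x. F (frame_map ?d 0 b y) * ?G (- (frame_map ?d 0 b y) + x) \<partial>lborel) \<partial>?M)"
    by (intro nn_integral_cong nn_integral_cmult [symmetric]) auto
  \<comment> \<open>The ball is symmetric about 0, so the argument may be negated. For fixed
    \<open>x\<close> the inner integral is then a slice integral with base point \<open>- x\<close>,
    which \<open>transl\<close> moves to 0.\<close>
  also have "\<dots> = (\<integral>\<^sup>+ y. (\<integral>\<^sup>+ x. F (frame_map ?d 0 b y) * ?G (- x + frame_map ?d 0 b y) \<partial>lborel) \<partial>?M)"
    by (intro nn_integral_cong) (auto simp: indicator_def norm_minus_commute)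
  also have "\<dots> = (\<integral>\<^sup>+ x. (\<integral>\<^sup>+ y. F (frame_map ?d 0 b y) * ?G (- x + frame_map ?d 0 b y) \<partial>?M) \<partial>lborel)"
    by (rule Fubini'[symmetric]) measurable
  also have "\<dots> = (\<integral>\<^sup>+ x. slice_integral ?d b (\<lambda>z. F (x + z) * ?G z) (- x) \<partial>lborel)"
    by (simp add: slice_integral_def frame_map_def)
  also have "\<dots> = (\<integral>\<^sup>+ x. slice_integral ?d b (\<lambda>z. F (x + z) * ?G z) 0 \<partial>lborel)"
    by (subst transl) auto
  also have "\<dots> = (\<integral>\<^sup>+ y. (\<integral>\<^sup>+ x. F (frame_map ?d 0 b y + x) * ?G (frame_map ?d 0 b y) \<partial>lborel) \<partial>?M)"
    unfolding slice_integral_def by (subst Fubini') (auto simp: add.commute)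
  also have "\<dots> = (\<integral>\<^sup>+ y. (\<integral>\<^sup>+ x. F x \<partial>lborel) * ?G (frame_map ?d 0 b y) \<partial>?M)"
    by (intro nn_integral_cong) (simp add: nn_integral_multc lb)
  also have "\<dots> = (\<integral>\<^sup>+ x. F x \<partial>lborel) * slice_integral ?d b ?G 0"
    unfolding slice_integral_def by (rule nn_integral_cmult) measurable
  finally have "slice_integral ?d b F 0 * ennreal (unit_ball_vol (real ?d))
      = (\<integral>\<^sup>+ x. F x \<partial>lborel) * ennreal (unit_ball_vol (real ?d))"
    unfolding G2 .
  moreover have "ennreal (unit_ball_vol (real ?d)) \<noteq> 0"
    using unit_ball_vol_pos[of "real ?d"] by (simp del: unit_ball_vol_pos)
  ultimately show ?thesis
    using transl [of F p]
    by (metis assms(1) ennreal_mult_cancel_left ennreal_neq_top mult.commute)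
qed

section \<open>Log-concavity of section volumes\<close>

text \<open>The multiplicative form admits zeros: \<open>0 powr l = 0\<close>, so the inequality is
  trivial once one of the two values vanishes.\<close>

definition log_concave :: "('a::real_vector \<Rightarrow> real) \<Rightarrow> bool" where
  "log_concave F \<longleftrightarrow> (\<forall>x. 0 \<le> F x) \<and>
     (\<forall>x y l. 0 < l \<longrightarrow> l < 1 \<longrightarrow> F x powr (1 - l) * F y powr l \<le> F ((1 - l) *\<^sub>R x + l *\<^sub>R y))"

lemma log_concaveD:
  assumes "log_concave F"
  shows "0 \<le> F x"
    and "\<lbrakk>0 < l; l < 1\<rbrakk> \<Longrightarrow> F x powr (1 - l) * F y powr l \<le> F ((1 - l) *\<^sub>R x + l *\<^sub>R y)"
  using assms by (auto simp: log_concave_def)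

section \<open>The Prekopa-Leindler inequality on the real line\<close>

lemma powr_weighted_less:
  fixes a b t l :: real
  assumes "0 \<le> t" "t < a" "t < b" "0 < l" "l < 1"
  shows "t < a powr (1 - l) * b powr l"
proof (cases "t = 0")
  case False
  then have "t powr (1 - l) * t powr l < a powr (1 - l) * b powr l"
    using assms by (intro mult_strict_mono powr_less_mono2) auto
  then show ?thesis using assms False by (simp flip: powr_add)
qed (use assms in auto)

lemma convex_superlevel:
  assumes "log_concave F" "0 \<le> t"
  shows "convex {x. t < F x}"
proof (rule convexI)
  fix x y u v assume x: "x \<in> {x. t < F x}" and y: "y \<in> {x. t < F x}"
    and uv: "0 \<le> u" "0 \<le> v" "u + v = (1::real)"
  show "u *\<^sub>R x + v *\<^sub>R y \<in> {x. t < F x}"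
  proof (cases "u = 0 \<or> v = 0")
    case False
    then have "0 < v" "v < 1" "u = 1 - v" using uv by auto
    then show ?thesis
      using powr_weighted_less [of t "F x" "F y" v] log_concaveD(2) [OF assms(1), of v x y] x y assms
      by auto
  qed (use x y uv in auto)
qed

text \<open>\<open>X\<close> is an interval from \<open>Inf X\<close> to \<open>Sup X\<close> that
  may lack its endpoints, hence the open parameter range. If \<open>p = q\<close>, the parametrized
  point is the only element of \<open>X\<close>.\<close>

lemma bounded_real_convex_bounds:
  fixes X :: "real set"
  assumes "convex X" "bounded X" "X \<noteq> {}"
  obtains p q where "p \<le> q" "X \<subseteq> {p..q}" "emeasure lborel X \<le> ennreal (q - p)"
    "\<And>\<theta>. \<lbrakk>0 < \<theta>; \<theta> < 1\<rbrakk> \<Longrightarrow> p + \<theta> * (q - p) \<in> X"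
proof -
  have bdd: "bdd_above X" "bdd_below X"
    using assms(2) by (auto intro: bounded_imp_bdd_above bounded_imp_bdd_below)
  define p q where "p = Inf X" and "q = Sup X"
  have sub: "X \<subseteq> {p..q}"
    unfolding p_def q_def using bdd by (auto intro: cInf_lower cSup_upper)
  have le: "p \<le> q" using sub assms(3) by force
  have mem: "p + \<theta> * (q - p) \<in> X" if "0 < \<theta>" "\<theta> < 1" for \<theta>
  proof (cases "p = q")
    case True
    then show ?thesis using sub assms(3) by auto
  next
    case False
    then have "0 < \<theta> * (q - p)" "\<theta> * (q - p) < 1 * (q - p)"
      using le that by (auto intro!: mult_pos_pos mult_strict_right_mono)
    then have "p < p + \<theta> * (q - p)" "p + \<theta> * (q - p) < q" by auto
    then obtain x y where "x \<in> X" "x < p + \<theta> * (q - p)" "y \<in> X" "p + \<theta> * (q - p) < y"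
      unfolding p_def q_def using assms(3) bdd by (metis cInf_less_iff less_cSup_iff)
    then show ?thesis
      using assms(1) by (meson convex_connected connectedD_interval less_imp_le)
  qed
  have "emeasure lborel X \<le> emeasure lborel {p..q}"
    using sub by (intro emeasure_mono) auto
  then show thesis using that le sub mem by simp
qed

text \<open>Brunn-Minkowski for intervals: a point of the open interval between the averaged
  endpoints is the average of the points of \<open>X\<close> and \<open>Y\<close> with the same
  relative position \<open>\<theta>\<close>.\<close>

lemma emeasure_convex_combination_ge:
  fixes X Y Z :: "real set"
  assumes X: "convex X" "bounded X" "X \<noteq> {}" and Y: "convex Y" "bounded Y" "Y \<noteq> {}"
    and l: "0 < l" "l < 1"
    and Z: "Z \<in> sets borel" "\<And>x y. \<lbrakk>x \<in> X; y \<in> Y\<rbrakk> \<Longrightarrow> (1 - l) * x + l * y \<in> Z"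
  shows "ennreal (1 - l) * emeasure lborel X + ennreal l * emeasure lborel Y \<le> emeasure lborel Z"
proof -
  obtain p q where pq: "p \<le> q" "emeasure lborel X \<le> ennreal (q - p)"
    "\<And>\<theta>. \<lbrakk>0 < \<theta>; \<theta> < 1\<rbrakk> \<Longrightarrow> p + \<theta> * (q - p) \<in> X"
    using bounded_real_convex_bounds [OF X] by metis
  obtain r s where rs: "r \<le> s" "emeasure lborel Y \<le> ennreal (s - r)"
    "\<And>\<theta>. \<lbrakk>0 < \<theta>; \<theta> < 1\<rbrakk> \<Longrightarrow> r + \<theta> * (s - r) \<in> Y"
    using bounded_real_convex_bounds [OF Y] by metis
  define u v where "u = (1 - l) * p + l * r" and "v = (1 - l) * q + l * s"
  have uv: "v - u = (1 - l) * (q - p) + l * (s - r)" by (simp add: u_def v_def algebra_simps)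
  then have "u \<le> v" using pq(1) rs(1) l
    by (metis add_nonneg_nonneg diff_ge_0_iff_ge less_imp_le mult_nonneg_nonneg)
  have sub: "{u<..<v} \<subseteq> Z"
  proof
    fix z assume z: "z \<in> {u<..<v}"
    define \<theta> where "\<theta> = (z - u) / (v - u)"
    have \<theta>: "0 < \<theta>" "\<theta> < 1" "z = u + \<theta> * (v - u)"
      using z by (auto simp: \<theta>_def)
    have "z = (1 - l) * (p + \<theta> * (q - p)) + l * (r + \<theta> * (s - r))"
      unfolding \<theta>(3) uv by (simp add: u_def algebra_simps)
    then show "z \<in> Z" using Z(2) pq(3) rs(3) \<theta> by blast
  qed
  have "ennreal (1 - l) * emeasure lborel X + ennreal l * emeasure lborel Y
      \<le> ennreal (1 - l) * ennreal (q - p) + ennreal l * ennreal (s - r)"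
    using pq rs by (intro add_mono mult_left_mono) auto
  also have "\<dots> = ennreal (v - u)"
    using pq rs l by (simp add: uv flip: ennreal_mult' ennreal_plus)
  also have "\<dots> = emeasure lborel {u<..<v}" using \<open>u \<le> v\<close> by simp
  also have "\<dots> \<le> emeasure lborel Z" using sub Z(1) by (intro emeasure_mono) auto
  finally show ?thesis .
qed

text \<open>Tonelli for the region under the graph. The half-open interval \<open>{0..<f x}\<close>
  leads to strict superlevel sets, and negative values of \<open>f\<close> contribute nothing on
  either side.\<close>

lemma nn_integral_layer_cake:
  fixes f :: "real \<Rightarrow> real"
  assumes [measurable]: "f \<in> borel_measurable borel"
  shows "(\<integral>\<^sup>+ x. ennreal (f x) \<partial>lborel)
    = (\<integral>\<^sup>+ t. indicator {0..} t * emeasure lborel {x. t < f x} \<partial>(lborel :: real measure))"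
proof -
  have "(\<integral>\<^sup>+ x. ennreal (f x) \<partial>lborel) = (\<integral>\<^sup>+ x. (\<integral>\<^sup>+ t. indicator {0..<f x} t \<partial>lborel) \<partial>lborel)"
  proof (intro nn_integral_cong)
    fix x show "ennreal (f x) = (\<integral>\<^sup>+ t. indicator {0..<f x} t \<partial>lborel)"
      by (cases "0 \<le> f x") (auto simp: ennreal_neg)
  qed
  also have "\<dots> = (\<integral>\<^sup>+ x. (\<integral>\<^sup>+ t. indicator {0..} t * indicator {x. t < f x} x \<partial>lborel) \<partial>lborel)"
    by (intro nn_integral_cong) (auto simp: indicator_def)
  also have "\<dots> = (\<integral>\<^sup>+ t. (\<integral>\<^sup>+ x. indicator {0..} t * indicator {x. t < f x} x \<partial>lborel) \<partial>lborel)"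
    by (rule lborel_pair.Fubini') measurable
  also have "\<dots> = (\<integral>\<^sup>+ t. indicator {0..} t * emeasure lborel {x. t < f x} \<partial>lborel)"
    by (intro nn_integral_cong) (subst nn_integral_cmult, auto)
  finally show ?thesis .
qed

text \<open>With both suprema equal to 1, the superlevel sets of \<open>f\<close> and
  \<open>g\<close> are nonempty for exactly the same levels \<open>0 \<le> t < 1\<close>. There they
  are bounded intervals, and their averages lie in the superlevel set of \<open>h\<close>;
  integrating the interval inequality over \<open>t\<close> gives the arithmetic mean on the
  left.\<close>

lemma prekopa_leindler_normalized:
  fixes f g h :: "real \<Rightarrow> real"
  assumes f: "log_concave f" "f \<in> borel_measurable borel" "bounded {x. f x \<noteq> 0}"
      "\<And>x. f x \<le> 1" "\<And>t. t < 1 \<Longrightarrow> \<exists>x. t < f x"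
    and g: "log_concave g" "g \<in> borel_measurable borel" "bounded {x. g x \<noteq> 0}"
      "\<And>x. g x \<le> 1" "\<And>t. t < 1 \<Longrightarrow> \<exists>x. t < g x"
    and h: "h \<in> borel_measurable borel"
    and l: "0 < l" "l < 1"
    and fgh: "\<And>x y. f x powr (1 - l) * g y powr l \<le> h ((1 - l) * x + l * y)"
  shows "ennreal (1 - l) * (\<integral>\<^sup>+ x. f x \<partial>lborel) + ennreal l * (\<integral>\<^sup>+ x. g x \<partial>lborel)
    \<le> (\<integral>\<^sup>+ x. h x \<partial>lborel)"
proof -
  note [measurable] = f(2) g(2) h
  have level: "ennreal (1 - l) * (indicator {0..} t * emeasure lborel {x. t < f x})
      + ennreal l * (indicator {0..} t * emeasure lborel {x. t < g x})
      \<le> indicator {0..} t * emeasure lborel {x. t < h x}" for t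
  proof (cases "0 \<le> t \<and> t < 1")
    case True
    have b: "bounded {x. t < f x}" "bounded {x. t < g x}"
      using True by (auto intro: bounded_subset [OF f(3)] bounded_subset [OF g(3)])
    have "ennreal (1 - l) * emeasure lborel {x. t < f x} + ennreal l * emeasure lborel {x. t < g x}
        \<le> emeasure lborel {x. t < h x}"
    proof (rule emeasure_convex_combination_ge)
      show "{x. t < f x} \<noteq> {}" "{x. t < g x} \<noteq> {}" using f(5) g(5) True by auto
      show "(1 - l) * x + l * y \<in> {x. t < h x}" if "x \<in> {x. t < f x}" "y \<in> {x. t < g x}" for x y
        using powr_weighted_less [of t "f x" "g y" l] fgh [of x y] that True l by auto
      show "{x. t < h x} \<in> sets borel" by measurable
    qed (use True l b f(1) g(1) convex_superlevel in auto)
    then show ?thesis using True by simp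
  next
    case False
    moreover have "{x. t < f x} = {}" "{x. t < g x} = {}" if "1 \<le> t"
      using f(4) g(4) that by (auto simp: not_less intro: order_trans)
    ultimately show ?thesis by (cases "0 \<le> t") auto
  qed
  have "(\<lambda>t. emeasure lborel {x. t < k x}) \<in> borel_measurable borel"
    if [measurable]: "k \<in> borel_measurable borel" for k :: "real \<Rightarrow> real"
  proof -
    have "(\<lambda>t. \<integral>\<^sup>+ x. indicator {x. t < k x} x \<partial>lborel) \<in> borel_measurable borel"
      by measurable
    then show ?thesis by simp
  qed
  note [measurable] = this [OF f(2)] this [OF g(2)]
  show ?thesis
    unfolding nn_integral_layer_cake [OF f(2)] nn_integral_layer_cake [OF g(2)]
      nn_integral_layer_cake [OF h]
    by (subst (1 2) nn_integral_cmult [symmetric], measurable,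
        subst nn_integral_add [symmetric], measurable)
       (intro nn_integral_mono level)
qed

lemma log_concave_scale:
  assumes "log_concave F" "0 < c"
  shows "log_concave (\<lambda>x. F x / c)"
  unfolding log_concave_def
proof (intro conjI allI impI)
  fix x y and l :: real assume "0 < l" "l < 1"
  then have "F x powr (1 - l) * F y powr l / c \<le> F ((1 - l) *\<^sub>R x + l *\<^sub>R y) / c"
    using assms by (intro divide_right_mono log_concaveD(2)) auto
  moreover have "(F x / c) powr (1 - l) * (F y / c) powr l = F x powr (1 - l) * F y powr l / c"
    using assms log_concaveD(1) [OF assms(1)]
    by (simp add: powr_divide flip: powr_add)
  ultimately show "(F x / c) powr (1 - l) * (F y / c) powr l \<le> F ((1 - l) *\<^sub>R x + l *\<^sub>R y) / c"
    by simp
qed (use assms log_concaveD(1) [OF assms(1)] in auto)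

text \<open>Dividing \<open>f\<close> and \<open>g\<close> by their suprema \<open>A\<close>,
  \<open>B\<close> and \<open>h\<close> by \<open>D = A powr (1 - l) * B powr l\<close> reduces to
  the normalized case; the weighted AM-GM inequality then turns the arithmetic mean into the
  geometric one. If one integral is 0, the left side vanishes.\<close>

lemma prekopa_leindler:
  fixes f g h :: "real \<Rightarrow> real"
  assumes f: "log_concave f" "f \<in> borel_measurable borel" "bounded {x. f x \<noteq> 0}" "\<And>x. f x \<le> C"
    and g: "log_concave g" "g \<in> borel_measurable borel" "bounded {x. g x \<noteq> 0}" "\<And>x. g x \<le> C"
    and h: "h \<in> borel_measurable borel"
    and l: "0 < l" "l < 1"
    and fgh: "\<And>x y. f x powr (1 - l) * g y powr l \<le> h ((1 - l) * x + l * y)"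
    and I: "(\<integral>\<^sup>+ x. f x \<partial>lborel) = ennreal I" "0 \<le> I"
    and J: "(\<integral>\<^sup>+ x. g x \<partial>lborel) = ennreal J" "0 \<le> J"
    and K: "(\<integral>\<^sup>+ x. h x \<partial>lborel) = ennreal K" "0 \<le> K"
  shows "I powr (1 - l) * J powr l \<le> K"
proof (cases "I = 0 \<or> J = 0")
  case False
  define A B where "A = (SUP x. f x)" and "B = (SUP x. g x)"
  have bdd: "bdd_above (range f)" "bdd_above (range g)" using f(4) g(4) by (auto intro!: bdd_aboveI2)
  have le: "f x \<le> A" "g x \<le> B" for x unfolding A_def B_def using bdd by (auto intro: cSUP_upper)
  have ex: "\<exists>x. t < f x" if "t < A" for t
    using that bdd less_cSUP_iff [of UNIV f t] by (auto simp: A_def)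
  have ex': "\<exists>x. t < g x" if "t < B" for t
    using that bdd less_cSUP_iff [of UNIV g t] by (auto simp: B_def)
  have "0 < A"
  proof (rule ccontr)
    assume "\<not> 0 < A"
    then have "f x = 0" for x using le(1) [of x] log_concaveD(1) [OF f(1), of x] by simp
    then show False using I False by simp
  qed
  have "0 < B"
  proof (rule ccontr)
    assume "\<not> 0 < B"
    then have "g x = 0" for x using le(2) [of x] log_concaveD(1) [OF g(1), of x] by simp
    then show False using J False by simp
  qed
  define D where "D = A powr (1 - l) * B powr l"
  have "0 < D" using \<open>0 < A\<close> \<open>0 < B\<close> by (simp add: D_def)
  have scale: "(\<integral>\<^sup>+ x. ennreal (k x / c) \<partial>lborel) = ennreal (M / c)"
    if [measurable]: "k \<in> borel_measurable borel" and "(\<integral>\<^sup>+ x. ennreal (k x) \<partial>lborel) = ennreal M" "0 < c"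
    for k :: "real \<Rightarrow> real" and c M
  proof -
    have "(\<integral>\<^sup>+ x. ennreal (k x / c) \<partial>lborel) = (\<integral>\<^sup>+ x. ennreal (1 / c) * ennreal (k x) \<partial>lborel)"
      using that by (intro nn_integral_cong) (simp flip: ennreal_mult')
    also have "\<dots> = ennreal (1 / c) * ennreal M" using that by (simp add: nn_integral_cmult)
    also have "\<dots> = ennreal (M / c)" using that by (simp flip: ennreal_mult')
    finally show ?thesis .
  qed
  have "ennreal (1 - l) * (\<integral>\<^sup>+ x. f x / A \<partial>lborel) + ennreal l * (\<integral>\<^sup>+ x. g x / B \<partial>lborel)
      \<le> (\<integral>\<^sup>+ x. h x / D \<partial>lborel)"
  proof (rule prekopa_leindler_normalized)
    show "(f x / A) powr (1 - l) * (g y / B) powr l \<le> h ((1 - l) * x + l * y) / D" for x y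
    proof -
      have "(f x / A) powr (1 - l) * (g y / B) powr l = f x powr (1 - l) * g y powr l / D"
        using \<open>0 < A\<close> \<open>0 < B\<close> log_concaveD(1) [OF f(1)] log_concaveD(1) [OF g(1)]
        by (simp add: powr_divide D_def)
      then show ?thesis using fgh [of x y] \<open>0 < D\<close> by (simp add: divide_right_mono)
    qed
    show "\<exists>x. t < f x / A" if "t < 1" for t
      using ex [of "t * A"] \<open>0 < A\<close> that by (auto simp: field_simps)
    show "\<exists>x. t < g x / B" if "t < 1" for t
      using ex' [of "t * B"] \<open>0 < B\<close> that by (auto simp: field_simps)
  qed (use f g h l le \<open>0 < A\<close> \<open>0 < B\<close> log_concave_scale in auto)
  then have "ennreal (1 - l) * ennreal (I / A) + ennreal l * ennreal (J / B) \<le> ennreal (K / D)"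
    using scale [OF f(2) I(1) \<open>0 < A\<close>] scale [OF g(2) J(1) \<open>0 < B\<close>] scale [OF h K(1) \<open>0 < D\<close>] by simp
  then have "(1 - l) * (I / A) + l * (J / B) \<le> K / D"
    using l I J K \<open>0 < A\<close> \<open>0 < B\<close> \<open>0 < D\<close>
    by (simp flip: ennreal_mult' ennreal_plus)
  moreover have "(I / A) powr (1 - l) * (J / B) powr l \<le> (1 - l) * (I / A) + l * (J / B)"
    using False I J \<open>0 < A\<close> \<open>0 < B\<close> l by (intro Youngs_inequality_0) auto
  moreover have "(I / A) powr (1 - l) * (J / B) powr l = I powr (1 - l) * J powr l / D"
    using I J \<open>0 < A\<close> \<open>0 < B\<close> by (simp add: powr_divide D_def)
  ultimately have "I powr (1 - l) * J powr l / D \<le> K / D" by simp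
  then show ?thesis using \<open>0 < D\<close> by (simp add: divide_le_cancel)
qed (use K in auto)

section \<open>Slice volumes of bounded convex sets\<close>

lemma orthonormal_frame_mono:
  "orthonormal_frame n b \<Longrightarrow> m \<le> n \<Longrightarrow> orthonormal_frame m b"
  by (auto simp: orthonormal_frame_def)

lemma slice_integral_nonzero:
  assumes "slice_integral m b (indicator S) p \<noteq> 0"
  obtains x where "x \<in> S" "x - p \<in> span (b ` {..<m})"
proof -
  have "\<exists>y. frame_map m p b y \<in> S"
  proof (rule ccontr)
    assume "\<not> ?thesis"
    then have "slice_integral m b (indicator S) p = 0"
      by (simp add: slice_integral_def indicator_def)
    with assms show False by simp
  qed
  then obtain y where "frame_map m p b y \<in> S" ..
  moreover have "frame_map m p b y - p \<in> span (b ` {..<m})"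
    by (auto simp: frame_map_def intro!: span_sum span_scale intro: span_base)
  ultimately show thesis using that by blast
qed

lemma orthonormal_frame_span_inner:
  assumes "orthonormal_frame n b" "m \<le> j" "j < n" "x \<in> span (b ` {..<m})"
  shows "x \<bullet> b j = 0"
proof -
  have "orthogonal (b j) x"
    using assms(4)
    by (rule orthogonal_to_span)
       (use assms(1-3) in \<open>auto simp: orthogonal_def orthonormal_frame_def\<close>)
  then show ?thesis by (simp add: orthogonal_def inner_commute)
qed

text \<open>The slice through \<open>p\<close> has constant inner product with every later frame
  vector, so it can meet \<open>S\<close> only if that product is at most \<open>R\<close> in
  absolute value. Each new direction thus contributes an interval of length \<open>2 * R\<close>.
  The bounds supply finiteness and bounded support for Prekopa-Leindler.\<close>

lemma slice_integral_bounded: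
  assumes "orthonormal_frame m b" "S \<subseteq> cball 0 R" "S \<in> sets borel" "0 \<le> R"
  shows "slice_integral m b (indicator S) p \<le> ennreal ((2 * R) ^ m)"
    and "slice_integral m b (indicator S) p \<noteq> 0 \<Longrightarrow> m \<le> j \<Longrightarrow> orthonormal_frame (Suc j) b
      \<Longrightarrow> \<bar>p \<bullet> b j\<bar> \<le> R"
proof -
  have supp: "\<bar>p \<bullet> b j\<bar> \<le> R"
    if nz: "slice_integral m b (indicator S) p \<noteq> 0" and j: "m \<le> j" "orthonormal_frame (Suc j) b"
    for p m j
  proof -
    obtain x where x: "x \<in> S" "x - p \<in> span (b ` {..<m})" using slice_integral_nonzero [OF nz] .
    have "(x - p) \<bullet> b j = 0"
      using orthonormal_frame_span_inner [OF j(2,1) _ x(2)] by simp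
    then have "p \<bullet> b j = x \<bullet> b j" by (simp add: inner_diff_left)
    moreover have "norm (b j) = 1" using j(2) by (simp add: orthonormal_frame_def norm_eq_1)
    moreover have "norm x \<le> R" using x(1) assms(2) by auto
    ultimately show ?thesis using Cauchy_Schwarz_ineq2 [of x "b j"] by simp
  qed
  then show "slice_integral m b (indicator S) p \<noteq> 0 \<Longrightarrow> m \<le> j \<Longrightarrow> orthonormal_frame (Suc j) b
      \<Longrightarrow> \<bar>p \<bullet> b j\<bar> \<le> R" by blast
  have [measurable]: "indicator S \<in> borel_measurable borel"
    using assms(3) by (rule borel_measurable_indicator)
  show "slice_integral m b (indicator S) p \<le> ennreal ((2 * R) ^ m)"
    using assms(1)
  proof (induction m arbitrary: p)
    case (Suc m)
    have bm: "b m \<bullet> b m = 1" using Suc.prems by (simp add: orthonormal_frame_def)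
    have IH: "slice_integral m b (indicator S) q \<le> ennreal ((2 * R) ^ m)" for q
      using Suc orthonormal_frame_mono by fastforce
    have "slice_integral m b (indicator S) (p + t *\<^sub>R b m)
        \<le> ennreal ((2 * R) ^ m) * indicator {- R - p \<bullet> b m..R - p \<bullet> b m} t" for t
    proof (cases "slice_integral m b (indicator S) (p + t *\<^sub>R b m) = 0")
      case False
      then show ?thesis
        using supp [of m "p + t *\<^sub>R b m" m] Suc.prems IH [of "p + t *\<^sub>R b m"] bm
        by (auto simp: indicator_def inner_add_left abs_le_iff)
    qed simp
    then have "slice_integral (Suc m) b (indicator S) p
        \<le> (\<integral>\<^sup>+ t. ennreal ((2 * R) ^ m) * indicator {- R - p \<bullet> b m..R - p \<bullet> b m} t \<partial>lborel)"
      by (simp add: slice_integral_Suc nn_integral_mono)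
    also have "\<dots> = ennreal ((2 * R) ^ Suc m)"
      using \<open>0 \<le> R\<close> by (simp add: nn_integral_cmult mult.commute flip: ennreal_mult')
    finally show ?case .
  qed (simp add: indicator_def)
qed

lemma log_concave_indicator:
  assumes "convex S"
  shows "log_concave (indicator S :: _ \<Rightarrow> real)"
  using assms by (auto simp: log_concave_def indicator_def convex_alt)

text \<open>Marginals of log-concave functions are log-concave. Starting from the indicator of a
  convex set, one direction at a time is integrated out by the one-dimensional inequality.\<close>

lemma log_concave_slice_volume:
  assumes "convex S" "bounded S" "S \<in> sets borel" "orthonormal_frame m b"
  shows "log_concave (\<lambda>p. enn2real (slice_integral m b (indicator S) p))"
proof -
  obtain R where R: "0 < R" "S \<subseteq> cball 0 R"
    using assms(2) by (metis bounded_pos bounded_subset_ballD cball_trivial subset_trans ball_subset_cball)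
  have [measurable]: "indicator S \<in> borel_measurable borel"
    using assms(3) by (rule borel_measurable_indicator)
  show ?thesis
    using assms(4)
  proof (induction m)
    case 0
    have "enn2real (indicator S p) = indicator S p" for p by (simp add: indicator_def)
    then show ?case using log_concave_indicator [OF assms(1)] by simp
  next
    case (Suc m)
    have om: "orthonormal_frame m b" using Suc.prems orthonormal_frame_mono by fastforce
    have bm: "b m \<bullet> b m = 1" using Suc.prems by (simp add: orthonormal_frame_def)
    define V where "V p = enn2real (slice_integral m b (indicator S) p)" for p
    have fin: "slice_integral m b (indicator S) p = ennreal (V p)" for p
      using slice_integral_bounded(1) [OF om R(2) assms(3), of p] R(1)
      unfolding V_def by (metis ennreal_enn2real ennreal_less_top less_imp_le order_le_less_trans)
    have [measurable]: "V \<in> borel_measurable borel"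
      unfolding V_def [abs_def] by measurable
    have lc: "log_concave V" using Suc.IH [OF om] by (simp add: V_def [abs_def])
    have V_le: "V p \<le> (2 * R) ^ m" for p
      using slice_integral_bounded(1) [OF om R(2) assms(3), of p] R(1) by (simp add: fin)
    have line: "log_concave (\<lambda>t. V (p + t *\<^sub>R b m))" "(\<lambda>t. V (p + t *\<^sub>R b m)) \<in> borel_measurable borel"
      "bounded {t. V (p + t *\<^sub>R b m) \<noteq> 0}" for p
    proof -
      show "log_concave (\<lambda>t. V (p + t *\<^sub>R b m))"
        unfolding log_concave_def
      proof (intro conjI allI impI)
        fix x y l :: real assume l: "0 < l" "l < 1"
        have "(1 - l) *\<^sub>R (p + x *\<^sub>R b m) + l *\<^sub>R (p + y *\<^sub>R b m) = p + ((1 - l) *\<^sub>R x + l *\<^sub>R y) *\<^sub>R b m"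
          by (simp add: algebra_simps)
        then show "V (p + x *\<^sub>R b m) powr (1 - l) * V (p + y *\<^sub>R b m) powr l
            \<le> V (p + ((1 - l) *\<^sub>R x + l *\<^sub>R y) *\<^sub>R b m)"
          using log_concaveD(2) [OF lc l] by metis
      qed (rule log_concaveD(1) [OF lc])
      show "(\<lambda>t. V (p + t *\<^sub>R b m)) \<in> borel_measurable borel" by measurable
      show "bounded {t. V (p + t *\<^sub>R b m) \<noteq> 0}"
      proof (rule boundedI)
        fix t assume "t \<in> {t. V (p + t *\<^sub>R b m) \<noteq> 0}"
        then have "slice_integral m b (indicator S) (p + t *\<^sub>R b m) \<noteq> 0" by (auto simp: V_def)
        then have "\<bar>(p + t *\<^sub>R b m) \<bullet> b m\<bar> \<le> R"
          using slice_integral_bounded(2) [OF om R(2) assms(3), of "p + t *\<^sub>R b m" m] R(1) Suc.prems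
          by (simp add: V_def)
        then show "norm t \<le> R + \<bar>p \<bullet> b m\<bar>" using bm by (simp add: inner_add_left)
      qed
    qed
    define W where "W p = enn2real (slice_integral (Suc m) b (indicator S) p)" for p
    have int: "(\<integral>\<^sup>+ t. V (p + t *\<^sub>R b m) \<partial>lborel) = ennreal (W p)" "0 \<le> W p" for p
    proof -
      have "slice_integral (Suc m) b (indicator S) p < top"
        using slice_integral_bounded(1) [OF Suc.prems R(2) assms(3), of p] R(1)
        by (meson ennreal_less_top less_imp_le order_le_less_trans)
      then show "(\<integral>\<^sup>+ t. V (p + t *\<^sub>R b m) \<partial>lborel) = ennreal (W p)" "0 \<le> W p"
        by (simp_all add: W_def slice_integral_Suc fin)
    qed
    have "log_concave W"
      unfolding log_concave_def
    proof (intro conjI allI impI)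
      fix p q and l :: real assume l: "0 < l" "l < 1"
      show "W p powr (1 - l) * W q powr l \<le> W ((1 - l) *\<^sub>R p + l *\<^sub>R q)"
      \<comment> \<open>The three functions are the restrictions of \<open>V\<close> to the parallel
        lines through \<open>p\<close>, \<open>q\<close> and their convex combination, all in
        direction \<open>b m\<close>.\<close>
      proof (rule prekopa_leindler [OF line V_le line V_le line(2) l _ int int int])
        fix x y
        have "(1 - l) *\<^sub>R (p + x *\<^sub>R b m) + l *\<^sub>R (q + y *\<^sub>R b m)
            = (1 - l) *\<^sub>R p + l *\<^sub>R q + ((1 - l) * x + l * y) *\<^sub>R b m"
          by (simp add: algebra_simps)
        then show "V (p + x *\<^sub>R b m) powr (1 - l) * V (q + y *\<^sub>R b m) powr l
            \<le> V ((1 - l) *\<^sub>R p + l *\<^sub>R q + ((1 - l) * x + l * y) *\<^sub>R b m)"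
          using log_concaveD(2) [OF lc l] by metis
      qed
    qed (rule int(2))
    then show ?case by (simp add: W_def [abs_def])
  qed
qed

section \<open>Sections of the positive orthant\<close>

definition coord_sum :: "real ^ 'n \<Rightarrow> real" where
  "coord_sum x = (\<Sum>i\<in>UNIV. x $ i)"

definition orthant :: "(real ^ 'n) set" where
  "orthant = {x. \<forall>i. 0 < x $ i}"

lemma coord_sum_simps [simp]:
  "coord_sum (x + y) = coord_sum x + coord_sum y"
  "coord_sum (x - y) = coord_sum x - coord_sum y"
  "coord_sum (c *\<^sub>R x) = c * coord_sum x"
  by (simp_all add: coord_sum_def sum.distrib sum_subtractf sum_distrib_left)

lemma coord_sum_inner: "coord_sum x = x \<bullet> 1"
  by (simp add: coord_sum_def inner_vec_def)

lemma coord_sum_axis [simp]: "coord_sum (axis i c) = c"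
  by (simp add: coord_sum_def axis_def)

lemma coord_sum_one [simp]: "coord_sum (1 :: real ^ 'n) = real CARD('n)"
  by (simp add: coord_sum_def)

lemma norm_one_vec: "norm (1 :: real ^ 'n) = sqrt (real CARD('n))"
  by (simp add: norm_eq_sqrt_inner inner_vec_def)

lemma coord_sum_measurable [measurable]: "coord_sum \<in> borel_measurable borel"
  unfolding coord_sum_def [abs_def] by measurable

lemma open_orthant: "open (orthant :: (real ^ 'n) set)"
proof -
  have "open (\<Inter>i. {x :: real ^ 'n. 0 < x $ i})"
    by (intro open_INT ballI open_Collect_less continuous_intros finite)
  moreover have "(\<Inter>i. {x :: real ^ 'n. 0 < x $ i}) = orthant" by (auto simp: orthant_def)
  ultimately show ?thesis by metis
qed

lemma orthant_borel [measurable]: "orthant \<in> sets borel"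
  by (rule borel_open [OF open_orthant])

lemma indicator_orthant_measurable [measurable]:
  "(indicator orthant :: real ^ 'n \<Rightarrow> ennreal) \<in> borel_measurable borel"
  by (rule borel_measurable_indicator) measurable

lemma convex_orthant: "convex orthant"
proof (rule convexI)
  fix x y :: "real ^ 'n" and u v :: real
  assume xy: "x \<in> orthant" "y \<in> orthant" and uv: "0 \<le> u" "0 \<le> v" "u + v = 1"
  show "u *\<^sub>R x + v *\<^sub>R y \<in> orthant"
  proof (cases "u = 0")
    case False
    then show ?thesis using xy uv by (auto simp: orthant_def less_imp_le intro!: add_pos_nonneg mult_nonneg_nonneg)
  qed (use xy uv in auto)
qed

lemma coord_sum_orthant_pos: "x \<in> orthant \<Longrightarrow> 0 < coord_sum x"
  by (auto simp: orthant_def coord_sum_def intro!: sum_pos)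

lemma norm_le_coord_sum: "x \<in> orthant \<Longrightarrow> norm x \<le> coord_sum x"
  using norm_le_l1_cart [of x] by (auto simp: orthant_def coord_sum_def abs_of_pos)

lemma bounded_orthant_coord_sum: "bounded (orthant \<inter> {x. coord_sum x < R})"
  by (rule boundedI [of _ R]) (auto dest: norm_le_coord_sum)

lemma open_simplex_eq: "open_simplex = {x \<in> orthant. coord_sum x = 1}"
  by (auto simp: open_simplex_def simplex_hyperplane_def orthant_def coord_sum_def)

lemma simplex_hyperplane_eq: "simplex_hyperplane = {x. coord_sum x = 1}"
  by (auto simp: simplex_hyperplane_def coord_sum_def)

section \<open>Frames of affine subspaces and the volume \<open>vol\<close>\<close>

lemma orthonormal_frame_extend:
  assumes "orthonormal_frame m b" "norm c = 1" "\<And>i. i < m \<Longrightarrow> b i \<bullet> c = 0"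
  shows "orthonormal_frame (Suc m) (b(m := c))"
  using assms by (auto simp: orthonormal_frame_def less_Suc_eq norm_eq_1 inner_commute)

text \<open>Gram-Schmidt inside the orthogonal complement of \<open>n\<close>: as long as
  \<open>m + 1\<close> vectors, \<open>n\<close> included, do not span the space, a further
  direction exists. Later \<open>n\<close> is the all-ones vector.\<close>

lemma ex_orthonormal_extension:
  fixes b :: "nat \<Rightarrow> 'a::euclidean_space"
  assumes "orthonormal_frame s b" "\<And>i. i < s \<Longrightarrow> b i \<bullet> n = 0" "s \<le> m" "m < DIM('a)"
  shows "\<exists>c. orthonormal_frame m c \<and> (\<forall>i<s. c i = b i) \<and> (\<forall>i<m. c i \<bullet> n = 0)"
  using assms(3,4)
proof (induction m rule: dec_induct)
  case (step m)
  then obtain c where c: "orthonormal_frame m c" "\<forall>i<s. c i = b i" "\<forall>i<m. c i \<bullet> n = 0"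
    by auto
  let ?S = "insert n (c ` {..<m})"
  have "dim ?S \<le> card ?S" by (rule dim_le_card') simp
  also have "\<dots> \<le> Suc (card (c ` {..<m}))" by (rule card_insert_le_m1) auto
  also have "\<dots> \<le> Suc m" using card_image_le [of "{..<m}" c] by simp
  finally have "dim ?S < DIM('a)" using step.prems by simp
  then obtain x where x: "x \<noteq> 0" "\<And>y. y \<in> span ?S \<Longrightarrow> orthogonal x y"
    using orthogonal_to_subspace_exists by blast
  define z where "z = x /\<^sub>R norm x"
  have z: "y \<bullet> z = 0" if "y \<in> ?S" for y
    using x(2) [of y] that by (auto simp: z_def orthogonal_def inner_commute intro: span_base)
  have "orthonormal_frame (Suc m) (c(m := z))"
    using c x(1) z by (intro orthonormal_frame_extend) (auto simp: z_def)
  moreover have "z \<bullet> n = 0" using z [of n] by (simp add: inner_commute)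
  then have "\<forall>i<Suc m. (c(m := z)) i \<bullet> n = 0" "\<forall>i<s. (c(m := z)) i = b i"
    using c step.hyps by (auto simp: less_Suc_eq)
  ultimately show ?case by blast
qed (use assms in auto)

lemma range_frame_map:
  assumes "orthonormal_frame s b"
  shows "range (frame_map s p b) = (+) p ` span (b ` {..<s})"
proof -
  have "(\<Sum>i<s. y i *\<^sub>R b i) \<in> span (b ` {..<s})" for y
    by (intro span_sum span_scale) (auto intro: span_base)
  moreover have "\<exists>y. x = (\<Sum>i<s. y i *\<^sub>R b i)" if "x \<in> span (b ` {..<s})" for x
  proof -
    have fin: "finite (b ` {..<s})" by simp
    have "x \<in> range (\<lambda>u. \<Sum>v\<in>b ` {..<s}. u v *\<^sub>R v)"
      using that span_finite [OF fin] by simp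
    then obtain u where "x = (\<Sum>v\<in>b ` {..<s}. u v *\<^sub>R v)" by (rule rangeE)
    also have "\<dots> = (\<Sum>i<s. u (b i) *\<^sub>R b i)"
      using span_orthonormal_frame(2) [OF assms] by (simp add: sum.reindex)
    finally show ?thesis by (rule exI [of _ "\<lambda>i. u (b i)"])
  qed
  ultimately show ?thesis by (fastforce simp: frame_map_def image_iff)
qed

lemma affine_range_frame_map:
  assumes "orthonormal_frame s b"
  shows "affine (range (frame_map s p b))" "aff_dim (range (frame_map s p b)) = int s"
proof -
  show "affine (range (frame_map s p b))"
    by (simp add: range_frame_map [OF assms] affine_translation subspace_imp_affine flip: affine_translation)
  show "aff_dim (range (frame_map s p b)) = int s"
    using span_orthonormal_frame(3) [OF assms]
    by (simp add: range_frame_map [OF assms] aff_dim_translation_eq aff_dim_subspace)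
qed

lemma ex_frame_of_affine:
  fixes L :: "'a::euclidean_space set"
  assumes "affine L" "aff_dim L = int s" "a \<in> L"
  shows "\<exists>b. orthonormal_frame s b \<and> L = range (frame_map s a b)"
proof -
  let ?D = "(+) (- a) ` L"
  have "subspace ?D" using assms affine_diffs_subspace by blast
  then obtain B where B: "B \<subseteq> ?D" "pairwise orthogonal B" "\<And>x. x \<in> B \<Longrightarrow> norm x = 1"
    "independent B" "card B = dim ?D" "span B = ?D"
    using orthonormal_basis_subspace by blast
  have "int (dim ?D) = int s"
    using aff_dim_eq_dim [of a L] assms by (simp add: hull_inc)
  then have "card B = s" using B(5) by simp
  moreover have "finite B" using B(4) by (simp add: independent_imp_finite)
  ultimately obtain b where b: "bij_betw b {..<s} B"
    by (metis atLeast0LessThan ex_bij_betw_nat_finite)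
  have o: "orthonormal_frame s b"
    unfolding orthonormal_frame_def
  proof (intro allI impI)
    fix i j assume ij: "i < s" "j < s"
    have mem: "b i \<in> B" "b j \<in> B" using b ij by (auto simp: bij_betw_def)
    show "b i \<bullet> b j = (if i = j then 1 else 0)"
    proof (cases "i = j")
      case True
      then show ?thesis using B(3) [OF mem(1)] by (simp add: norm_eq_1)
    next
      case False
      then have "b i \<noteq> b j" using b ij by (auto simp: bij_betw_def inj_on_def)
      then show ?thesis using B(2) mem False by (auto simp: pairwise_def orthogonal_def)
    qed
  qed
  have "b ` {..<s} = B" using b by (simp add: bij_betw_def)
  then have "range (frame_map s a b) = (+) a ` ?D"
    by (simp add: range_frame_map [OF o] B(6))
  also have "\<dots> = L" by (simp add: image_image)
  finally show ?thesis using o by auto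
qed

text \<open>The frame selected by \<open>SOME\<close> is only known to generate a subspace
  containing \<open>S\<close>. Equality of dimensions forces that subspace to be the affine
  hull.\<close>

lemma vol_eq_frame_vol:
  fixes S :: "'a::euclidean_space set"
  assumes "S \<noteq> {}" "aff_dim S = int s"
  shows "\<exists>p b. orthonormal_frame s b \<and> range (frame_map s p b) = affine hull S
    \<and> vol s S = frame_vol s p b S"
proof -
  define Q where "Q = (\<lambda>(p, b). orthonormal_frame s b \<and> S \<subseteq> range (frame_map s p b))"
  obtain a where "a \<in> S" using assms(1) by blast
  then have "a \<in> affine hull S" by (rule hull_inc)
  then obtain b where "orthonormal_frame s b" "affine hull S = range (frame_map s a b)"
    using ex_frame_of_affine [of "affine hull S" s a] assms(2) by auto
  then have "Q (a, b)" by (auto simp: Q_def hull_inc)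
  then have "Q (SOME z. Q z)" by (rule someI)
  moreover obtain p c where pc: "(SOME z. Q z) = (p, c)" by (cases "SOME z. Q z")
  ultimately have *: "orthonormal_frame s c" "S \<subseteq> range (frame_map s p c)" by (auto simp: Q_def)
  have "affine hull S \<subseteq> range (frame_map s p c)"
    using *(2) affine_range_frame_map(1) [OF *(1)] by (rule hull_minimal)
  then have "affine hull S = range (frame_map s p c)"
    using affine_range_frame_map [OF *(1)] assms by (intro affine_dim_equal) auto
  moreover have "vol s S = frame_vol s p c S"
    using pc by (simp add: vol_def Q_def case_prod_unfold split_beta)
  ultimately show ?thesis using *(1) by metis
qed

lemma orthonormal_frame_in_hyperplane:
  fixes b :: "nat \<Rightarrow> real ^ 'n"
  assumes "range (frame_map s p b) \<subseteq> simplex_hyperplane"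
  shows "coord_sum p = 1" "i < s \<Longrightarrow> b i \<bullet> 1 = 0"
proof -
  have *: "coord_sum (frame_map s p b y) = 1" for y
    using assms by (auto simp: simplex_hyperplane_eq)
  show p: "coord_sum p = 1" using * [of "\<lambda>_. 0"] by (simp add: frame_map_def)
  show "b i \<bullet> 1 = 0" if "i < s"
  proof -
    have "(\<Sum>j<s. (if j = i then 1 else 0) *\<^sub>R b j) = b i"
      using that by (simp add: if_distrib [of "\<lambda>c. c *\<^sub>R _"] cong: if_cong)
    then show ?thesis
      using * [of "\<lambda>j. if j = i then 1 else 0"] p
      by (simp add: frame_map_def flip: coord_sum_inner)
  qed
qed

lemma coord_sum_span:
  fixes b :: "nat \<Rightarrow> real ^ 'n"
  assumes "\<And>i. i < m \<Longrightarrow> b i \<bullet> 1 = 0" "q \<in> span (b ` {..<m})"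
  shows "coord_sum q = 0"
proof -
  have "orthogonal 1 q"
    using assms(2) by (rule orthogonal_to_span) (use assms(1) in \<open>auto simp: orthogonal_def inner_commute\<close>)
  then show ?thesis by (simp add: coord_sum_inner orthogonal_def inner_commute)
qed

lemma coord_sum_frame_map:
  fixes b :: "nat \<Rightarrow> real ^ 'n"
  assumes "\<And>i. i < m \<Longrightarrow> b i \<bullet> 1 = 0"
  shows "coord_sum (frame_map m p b y) = coord_sum p"
  using assms by (simp add: frame_map_def coord_sum_inner inner_add_left inner_sum_left)

text \<open>The coordinate sum is constant on such a slice, so the orthant can be cut off at height
  \<open>R\<close>. This makes the results on bounded convex sets available.\<close>

lemma slice_integral_orthant_truncate:
  fixes b :: "nat \<Rightarrow> real ^ 'n"
  assumes "\<And>i. i < m \<Longrightarrow> b i \<bullet> 1 = 0" "coord_sum p < R"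
  shows "slice_integral m b (indicator orthant) p
    = slice_integral m b (indicator (orthant \<inter> {x. coord_sum x < R})) p"
  using assms by (simp add: slice_integral_def indicator_def coord_sum_frame_map)

section \<open>Section volumes of the orthant as a function of the base point\<close>

definition orthant_section :: "nat \<Rightarrow> (nat \<Rightarrow> real ^ 'n) \<Rightarrow> real ^ 'n \<Rightarrow> real" where
  "orthant_section m b p = enn2real (slice_integral m b (indicator orthant) p)"

text \<open>Frames consisting of directions of the hyperplane of the simplex. Parallel sections of
  the orthant are then bounded, so \<open>V\<close> is finite everywhere.\<close>

locale level_frame =
  fixes m :: nat and b :: "nat \<Rightarrow> real ^ 'n"
  assumes frame: "orthonormal_frame m b"
    and level: "\<And>i. i < m \<Longrightarrow> b i \<bullet> 1 = 0"
begin

abbreviation "V \<equiv> orthant_section m b"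

lemma truncated_borel: "orthant \<inter> {x :: real ^ 'n. coord_sum x < R} \<in> sets borel"
  by measurable

lemma slice_integral_orthant: "slice_integral m b (indicator orthant) p = ennreal (V p)"
proof -
  let ?S = "orthant \<inter> {x :: real ^ 'n. coord_sum x < coord_sum p + 1}"
  obtain R where R: "0 < R" "?S \<subseteq> cball 0 R"
    by (metis bounded_orthant_coord_sum bounded_pos mem_cball_0 subsetI)
  have "slice_integral m b (indicator ?S) p \<le> ennreal ((2 * R) ^ m)"
    using R by (intro slice_integral_bounded(1) [OF frame] truncated_borel) auto
  also have "\<dots> < top" by simp
  finally have "slice_integral m b (indicator orthant) p < top"
    using slice_integral_orthant_truncate [of m b p "coord_sum p + 1"] level by simp
  then show ?thesis by (simp add: orthant_section_def)
qed

lemma section_nonneg [simp]: "0 \<le> V p"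
  by (simp add: orthant_section_def)

lemma section_translate: "q \<in> span (b ` {..<m}) \<Longrightarrow> V (p + q) = V p"
  by (simp add: orthant_section_def slice_integral_translate)

lemma log_concave_section: "log_concave V"
  unfolding log_concave_def
proof (intro conjI allI impI)
  fix x y :: "real ^ 'n" and l :: real assume l: "0 < l" "l < 1"
  \<comment> \<open>A single truncation height lies above \<open>x\<close>, \<open>y\<close> and all
    their convex combinations.\<close>
  define R where "R = max (coord_sum x) (coord_sum y) + 1"
  let ?S = "orthant \<inter> {x :: real ^ 'n. coord_sum x < R}"
  have R: "coord_sum x < R" "coord_sum y < R" by (auto simp: R_def)
  have "convex {x :: real ^ 'n. coord_sum x < R}"
    using convex_halfspace_lt [of 1 R] by (simp add: coord_sum_inner inner_commute)
  then have c: "convex ?S" by (intro convex_Int convex_orthant)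
  then have "log_concave (\<lambda>p. enn2real (slice_integral m b (indicator ?S) p))"
    by (intro log_concave_slice_volume frame bounded_orthant_coord_sum truncated_borel)
  moreover have "coord_sum ((1 - l) *\<^sub>R x + l *\<^sub>R y) < R"
    using convexD [OF \<open>convex {x :: real ^ 'n. coord_sum x < R}\<close>, of x y "1 - l" l] R l by simp
  ultimately show "V x powr (1 - l) * V y powr l \<le> V ((1 - l) *\<^sub>R x + l *\<^sub>R y)"
    using slice_integral_orthant_truncate [of m b _ R] level R l
    unfolding orthant_section_def by (metis (no_types, lifting) log_concaveD(2))
qed simp

text \<open>Translation by \<open>y\<close> carries the orthant part of the slice through
  \<open>p\<close> into the orthant part of the slice through \<open>p + y\<close>.\<close>

lemma section_mono:
  assumes "\<And>i. 0 \<le> y $ i"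
  shows "V p \<le> V (p + y)"
proof -
  have "slice_integral m b (indicator orthant) p \<le> slice_integral m b (\<lambda>x. indicator orthant (x + y)) p"
    using assms by (intro slice_integral_mono) (auto simp: indicator_def orthant_def add_pos_nonneg)
  also have "\<dots> = slice_integral m b (indicator orthant) (p + y)"
    by (simp add: slice_integral_def frame_map_def algebra_simps)
  finally show ?thesis by (simp add: slice_integral_orthant)
qed

lemma section_pos:
  assumes "p \<in> orthant"
  shows "0 < V p"
proof -
  obtain r where r: "0 < r" "cball p r \<subseteq> orthant"
    using open_orthant assms open_contains_cball by blast
  have "ennreal (unit_ball_vol (real m) * r ^ m) = slice_integral m b (indicator (cball 0 r)) 0"
    using slice_integral_indicator_cball [OF frame r(1)] by simp
  also have "\<dots> \<le> slice_integral m b (\<lambda>x. indicator orthant (x + p)) 0"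
    using r(2) by (intro slice_integral_mono) (force simp: indicator_def dist_norm norm_minus_commute)
  also have "\<dots> = slice_integral m b (indicator orthant) p"
    by (simp add: slice_integral_def frame_map_def algebra_simps)
  finally have "unit_ball_vol (real m) * r ^ m \<le> V p" by (simp add: slice_integral_orthant)
  moreover have "0 < unit_ball_vol (real m) * r ^ m" using r(1) by simp
  ultimately show ?thesis by linarith
qed

text \<open>The orthant is a cone, so its indicator is invariant under dilation and only the
  Jacobian \<open>c ^ m\<close> remains.\<close>

lemma section_scale:
  assumes "0 < c"
  shows "V (c *\<^sub>R p) = c ^ m * V p"
proof -
  have "slice_integral m b (indicator orthant) (c *\<^sub>R p)
      = ennreal (c ^ m) * slice_integral m b (indicator orthant) p"
    using assms
    by (intro slice_integral_scale) (auto simp: indicator_def orthant_def zero_less_mult_iff)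
  then show ?thesis using assms by (simp add: slice_integral_orthant flip: ennreal_mult')
qed

lemma section_eq_0: "coord_sum p \<le> 0 \<Longrightarrow> V p = 0"
proof (rule ccontr)
  assume p: "coord_sum p \<le> 0" and "V p \<noteq> 0"
  then have "slice_integral m b (indicator orthant) p \<noteq> 0" by (auto simp: orthant_section_def)
  then obtain x where "x \<in> orthant" "x - p \<in> span (b ` {..<m})" by (rule slice_integral_nonzero)
  then show False using coord_sum_span [of m b "x - p"] level coord_sum_orthant_pos [of x] p by simp
qed

end

text \<open>Bridge from \<open>vol\<close> to \<open>orthant_section\<close>. The intersection is
  nonempty and relatively open in \<open>L\<close>, so its affine hull is \<open>L\<close>. The
  frame behind \<open>vol\<close> may have another base point \<open>p\<close>; translation
  invariance moves it to \<open>a\<close>.\<close>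

lemma simplex_section_vol:
  fixes L :: "(real ^ 'n) set"
  assumes L: "affine L" "L \<subseteq> simplex_hyperplane" "a \<in> open_simplex \<inter> L" "aff_dim L = int s"
  shows "\<exists>b. level_frame s b \<and> L = range (frame_map s a b)
    \<and> vol s (open_simplex \<inter> L) = orthant_section s b a"
proof -
  have eq: "open_simplex \<inter> L = L \<inter> orthant"
    using L(2) by (auto simp: open_simplex_eq simplex_hyperplane_eq)
  have hull: "affine hull (open_simplex \<inter> L) = L"
    unfolding eq using L(1,3) eq by (subst affine_hull_affine_Int_open [OF _ open_orthant]) auto
  then have "aff_dim (open_simplex \<inter> L) = int s"
    using L(4) aff_dim_affine_hull [of "open_simplex \<inter> L"] by simp
  then obtain p b where b: "orthonormal_frame s b" "range (frame_map s p b) = L"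
    "vol s (open_simplex \<inter> L) = frame_vol s p b (open_simplex \<inter> L)"
    using vol_eq_frame_vol [of "open_simplex \<inter> L" s] L(3) hull by auto
  interpret level_frame s b
    using b orthonormal_frame_in_hyperplane(2) [of s p b] L(2) by unfold_locales auto
  have ap: "a - p \<in> span (b ` {..<s})"
    using L(3) b(2) range_frame_map [OF b(1), of p] by auto
  have "{x \<in> space (Pi\<^sub>M {..<s} (\<lambda>_. lborel)). frame_map s p b x \<in> open_simplex \<inter> L}
      = {x \<in> space (Pi\<^sub>M {..<s} (\<lambda>_. lborel)). frame_map s p b x \<in> orthant}"
    unfolding eq using b(2) by auto
  then have "vol s (open_simplex \<inter> L) = frame_vol s p b orthant"
    unfolding b(3) frame_vol_def by simp
  also have "\<dots> = V p" by (simp add: frame_vol_eq_slice_integral orthant_section_def)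
  also have "\<dots> = V a" using section_translate [OF ap, of p] by simp
  finally have "vol s (open_simplex \<inter> L) = V a" .
  moreover have "range (frame_map s a b) = L"
  proof -
    have "(+) a ` span (b ` {..<s}) = (+) p ` (+) (a - p) ` span (b ` {..<s})"
      by (simp add: image_image)
    also have "(+) (a - p) ` span (b ` {..<s}) = span (b ` {..<s})"
    proof (intro subset_antisym subsetI)
      fix x assume "x \<in> span (b ` {..<s})"
      then have "x - (a - p) \<in> span (b ` {..<s})" using ap by (rule span_diff)
      then show "x \<in> (+) (a - p) ` span (b ` {..<s})" by (rule rev_image_eqI) simp
    qed (use ap span_add in auto)
    finally show ?thesis using b range_frame_map [OF b(1)] by simp
  qed
  ultimately show ?thesis using level_frame_axioms by auto
qed

section \<open>The lower bound\<close>

definition orthant_exp :: "real ^ 'n \<Rightarrow> real ^ 'n \<Rightarrow> ennreal" where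
  "orthant_exp u x = indicator orthant x * ennreal (exp (- (u \<bullet> x)))"

lemma orthant_exp_measurable [measurable]: "orthant_exp u \<in> borel_measurable borel"
  unfolding orthant_exp_def [abs_def] by measurable

text \<open>The Gamma integral after the substitution \<open>c * t\<close>. The half-line is open to
  match the open orthant.\<close>

lemma nn_integral_power_exp:
  assumes "0 < c"
  shows "(\<integral>\<^sup>+ t. indicator {0<..} t * ennreal ((c * t) ^ k * exp (- (c * t))) \<partial>lborel)
    = ennreal (fact k / c)"
proof -
  let ?g = "\<lambda>t :: real. indicator {0<..} t * ennreal (t ^ k * exp (- t))"
  have "ennreal (fact k) = (\<integral>\<^sup>+ t. ennreal (t ^ k * exp (- t)) * indicator {0..} t \<partial>lborel)"
    using nn_intergal_power_times_exp_Ici [of k] by (simp add: ennreal_of_nat_eq_real_of_nat)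
  also have "\<dots> = (\<integral>\<^sup>+ t. ?g t \<partial>lborel)"
    using AE_lborel_singleton [of "0 :: real"]
    by (intro nn_integral_cong_AE) (auto simp: indicator_def elim!: eventually_mono)
  also have "\<dots> = ennreal c * (\<integral>\<^sup>+ t. ?g (0 + c * t) \<partial>lborel)"
    using assms by (subst nn_integral_real_affine [of _ c 0]) auto
  also have "(\<integral>\<^sup>+ t. ?g (0 + c * t) \<partial>lborel)
      = (\<integral>\<^sup>+ t. indicator {0<..} t * ennreal ((c * t) ^ k * exp (- (c * t))) \<partial>lborel)"
    using assms by (intro nn_integral_cong) (auto simp: indicator_def zero_less_mult_iff)
  finally have *: "ennreal (fact k) = ennreal c * \<dots>" .
  have "ennreal (fact k / c) = ennreal (1 / c) * ennreal (fact k)"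
    using assms by (simp flip: ennreal_mult')
  also have "\<dots> = (\<integral>\<^sup>+ t. indicator {0<..} t * ennreal ((c * t) ^ k * exp (- (c * t))) \<partial>lborel)"
    unfolding * using assms by (simp flip: ennreal_mult' mult.assoc)
  finally show ?thesis ..
qed

lemma Basis_vec_real: "(Basis :: (real ^ 'n) set) = range (\<lambda>i. axis i 1)"
  by (auto simp: Basis_vec_def)

lemma prod_Basis_vec: "(\<Prod>b\<in>Basis. g b) = (\<Prod>i\<in>UNIV. g (axis i (1 :: real) :: real ^ 'n))"
proof -
  have "inj (\<lambda>i. axis i (1 :: real) :: real ^ 'n)" by (auto simp: inj_on_def axis_eq_axis)
  then show ?thesis unfolding Basis_vec_real by (simp add: prod.reindex)
qed

text \<open>The integrand is a product of functions of single coordinates, so the integral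
  factors.\<close>

lemma nn_integral_orthant_exp:
  assumes "\<And>i. 0 < u $ i"
  shows "(\<integral>\<^sup>+ x. orthant_exp u x \<partial>lborel) = ennreal (1 / (\<Prod>i\<in>UNIV. u $ i))"
proof -
  let ?f = "\<lambda>b t. indicator {0<..} t * exp (- ((u \<bullet> b) * t)) :: real"
  have eq: "orthant_exp u x = ennreal (\<Prod>b\<in>Basis. ?f b (x \<bullet> b))" for x
  proof (cases "x \<in> orthant")
    case True
    have "u \<bullet> x = (\<Sum>i\<in>UNIV. u $ i * x $ i)" by (simp add: inner_vec_def)
    with True have "(\<Prod>i\<in>UNIV. ?f (axis i 1) (x $ i)) = exp (- (u \<bullet> x))"
      by (simp add: orthant_def inner_axis exp_sum flip: sum_negf)
    then show ?thesis
      using True by (simp add: orthant_exp_def prod_Basis_vec inner_axis)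
  next
    case False
    then have "(\<Prod>i\<in>UNIV. ?f (axis i 1) (x $ i)) = 0"
      by (auto simp: orthant_def indicator_def)
    then have "(\<Prod>b\<in>Basis. ?f b (x \<bullet> b)) = 0"
      by (simp add: prod_Basis_vec inner_axis)
    then show ?thesis
      using False unfolding orthant_exp_def by (simp only:) simp
  qed
  have "(\<integral>\<^sup>+ x. orthant_exp u x \<partial>lborel) = (\<Prod>b\<in>Basis. (\<integral>\<^sup>+ t. ennreal (?f b t) \<partial>lborel))"
    unfolding eq by (subst nn_integral_lborel_prod [symmetric]) (auto simp: prod_ennreal)
  also have "\<dots> = (\<Prod>i\<in>UNIV. ennreal (1 / u $ i))"
    unfolding prod_Basis_vec
  proof (intro prod.cong refl)
    fix i
    have "(\<integral>\<^sup>+ t. ennreal (?f (axis i 1) t) \<partial>lborel)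
        = (\<integral>\<^sup>+ t. indicator {0<..} t * ennreal ((u $ i * t) ^ 0 * exp (- (u $ i * t))) \<partial>lborel)"
      by (intro nn_integral_cong) (auto simp: inner_axis indicator_def)
    then show "(\<integral>\<^sup>+ t. ennreal (?f (axis i 1) t) \<partial>lborel) = ennreal (1 / u $ i)"
      using nn_integral_power_exp [of "u $ i" 0] assms by simp
  qed
  also have "\<dots> = ennreal (1 / (\<Prod>i\<in>UNIV. u $ i))"
    using assms by (subst prod_ennreal) (auto simp: less_imp_le prod_dividef)
  finally show ?thesis .
qed

lemma span_orthonormal_complement:
  fixes b :: "nat \<Rightarrow> 'a::euclidean_space"
  assumes b: "orthonormal_frame (Suc m) b" "Suc m = DIM('a)" and x: "x \<bullet> b m = 0"
  shows "x \<in> span (b ` {..<m})"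
proof -
  have "x \<in> span (insert (b m) (b ` {..<m}))"
    using span_full_orthonormal_frame [of b] b by (simp flip: image_insert lessThan_Suc)
  then obtain c where c: "x - c *\<^sub>R b m \<in> span (b ` {..<m})"
    using span_breakdown [of "b m" "insert (b m) (b ` {..<m})"] span_breakdown_eq by blast
  then have "(x - c *\<^sub>R b m) \<bullet> b m = 0"
    using orthonormal_frame_span_inner [OF b(1)] by blast
  moreover have "b m \<bullet> b m = 1" using b by (simp add: orthonormal_frame_def)
  ultimately have "c = 0" using x by (simp add: inner_diff_left)
  then show ?thesis using c by simp
qed

definition unit_diagonal :: "real ^ 'n" where
  "unit_diagonal = (1 / sqrt (real CARD('n))) *\<^sub>R 1"

lemma unit_diagonal [simp]:
  "norm (unit_diagonal :: real ^ 'n) = 1"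
  "coord_sum (unit_diagonal :: real ^ 'n) = sqrt (real CARD('n))"
  "(x :: real ^ 'n) \<bullet> unit_diagonal = coord_sum x / sqrt (real CARD('n))"
proof -
  show "norm (unit_diagonal :: real ^ 'n) = 1" by (simp add: unit_diagonal_def norm_one_vec)
  show "coord_sum (unit_diagonal :: real ^ 'n) = sqrt (real CARD('n))"
    by (simp add: unit_diagonal_def real_div_sqrt)
  show "(x :: real ^ 'n) \<bullet> unit_diagonal = coord_sum x / sqrt (real CARD('n))"
    by (simp add: unit_diagonal_def coord_sum_inner)
qed

context level_frame begin

lemma slice_integral_orthant_exp:
  assumes "\<And>i. i < m \<Longrightarrow> b i \<bullet> u = 0"
  shows "slice_integral m b (orthant_exp u) p = ennreal (exp (- (u \<bullet> p)) * V p)"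
proof -
  have "u \<bullet> frame_map m p b y = u \<bullet> p" for y
    using assms by (simp add: frame_map_def inner_add_right inner_sum_right inner_commute)
  then have "slice_integral m b (orthant_exp u) p
      = (\<integral>\<^sup>+ y. ennreal (exp (- (u \<bullet> p))) * indicator orthant (frame_map m p b y)
          \<partial>Pi\<^sub>M {..<m} (\<lambda>_. lborel))"
    by (simp add: slice_integral_def orthant_exp_def mult.commute)
  also have "\<dots> = ennreal (exp (- (u \<bullet> p))) * slice_integral m b (indicator orthant) p"
    unfolding slice_integral_def by (rule nn_integral_cmult) measurable
  finally show ?thesis by (simp add: slice_integral_orthant ennreal_mult')
qed

text \<open>Computes the integral of \<open>exp (- coord_sum x)\<close> over the orthant twice: it
  is 1 as a product, and slicing perpendicular to the diagonal gives \<open>V a\<close> times the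
  Gamma integral \<open>fact m / ?r\<close>, because section volumes scale with the power
  \<open>m\<close> of the coordinate sum.\<close>

lemma section_simplex:
  assumes m: "Suc m = CARD('n)" and a: "coord_sum a = 1"
  shows "V a = sqrt (real CARD('n)) / fact m"
proof -
  let ?r = "sqrt (real CARD('n))" and ?n = "unit_diagonal :: real ^ 'n"
  define B where "B = b(m := ?n)"
  have B: "orthonormal_frame (Suc m) B"
    unfolding B_def using frame level
    by (intro orthonormal_frame_extend) (simp_all add: coord_sum_inner)
  have Bb: "B i = b i" if "i < m" for i using that by (simp add: B_def)
  have im: "B ` {..<m} = b ` {..<m}" using Bb by (intro image_cong) auto
  have "?r > 0" by simp
  have sec: "ennreal (exp (- (1 \<bullet> (t *\<^sub>R ?n))) * V (t *\<^sub>R ?n))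
      = ennreal (V a) * (indicator {0<..} t * ennreal ((?r * t) ^ m * exp (- (?r * t))))" for t
  proof (cases "0 < t")
    case True
    \<comment> \<open>Both terms have coordinate sum \<open>?r * t\<close>, so \<open>?q\<close> is
      orthogonal to the diagonal and hence lies in the span of the frame.\<close>
    let ?q = "t *\<^sub>R ?n - (?r * t) *\<^sub>R a"
    have "?q \<in> span (b ` {..<m})"
      unfolding im [symmetric]
      by (rule span_orthonormal_complement [OF B]) (simp_all add: m a B_def)
    from section_translate [OF this, of "(?r * t) *\<^sub>R a"]
    have "V (t *\<^sub>R ?n) = V ((?r * t) *\<^sub>R a)" by simp
    also have "\<dots> = (?r * t) ^ m * V a" using True by (intro section_scale) auto
    finally have "V (t *\<^sub>R ?n) = (?r * t) ^ m * V a" .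
    moreover have "1 \<bullet> (t *\<^sub>R ?n) = ?r * t"
      by (simp add: inner_commute [of 1] del: unit_diagonal(3) flip: coord_sum_inner)
    ultimately show ?thesis
      using True by (simp add: mult_ac flip: ennreal_mult')
  next
    case False
    then have "V (t *\<^sub>R ?n) = 0" by (intro section_eq_0) (simp add: mult_nonpos_nonneg)
    then show ?thesis using False by simp
  qed
  have "1 = slice_integral (Suc m) B (orthant_exp 1) 0"
    using slice_integral_full [of "orthant_exp 1" B 0] B nn_integral_orthant_exp [of "1 :: real ^ 'n"]
    by (simp add: m)
  also have "\<dots> = (\<integral>\<^sup>+ t. slice_integral m b (orthant_exp 1) (t *\<^sub>R ?n) \<partial>lborel)"
    using slice_integral_cong [of m B b] Bb
    by (simp add: slice_integral_Suc B_def)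
  also have "\<dots> = (\<integral>\<^sup>+ t. ennreal (V a) * (indicator {0<..} t * ennreal ((?r * t) ^ m * exp (- (?r * t)))) \<partial>lborel)"
    using level by (subst slice_integral_orthant_exp) (auto simp only: sec)
  also have "\<dots> = ennreal (V a * (fact m / ?r))"
    by (subst nn_integral_cmult) (use nn_integral_power_exp [OF \<open>?r > 0\<close>, of m] in \<open>auto simp flip: ennreal_mult'\<close>)
  finally have "V a * (fact m / ?r) = 1" by (metis ennreal_eq_1)
  moreover have "V a = V a * (fact m / ?r) * (?r / fact m)" by simp
  ultimately show ?thesis by (metis mult_1)
qed

end

text \<open>Separates \<open>(a, 0)\<close> from the strict hypograph of
  \<open>ln (F / F a)\<close>. Positivity of \<open>F\<close> near \<open>a\<close> excludes a
  vertical separating hyperplane, so its normal \<open>(w, c)\<close> can be divided by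
  \<open>c\<close>, which gives the slope \<open>- w / c\<close>.\<close>

lemma log_concave_supergradient:
  fixes F :: "'a::euclidean_space \<Rightarrow> real"
  assumes F: "log_concave F" and U: "open U" "a \<in> U" "\<And>x. x \<in> U \<Longrightarrow> 0 < F x"
  shows "\<exists>u. \<forall>v. F v \<le> F a * exp (u \<bullet> (v - a))"
proof -
  have Fa: "0 < F a" using U by blast
  \<comment> \<open>The hypograph is written without a logarithm, so that points with
    \<open>F = 0\<close> are simply absent from it.\<close>
  let ?E = "{p. F a * exp (snd p) < F (fst p)}"
  have "convex ?E"
    unfolding convex_alt
  proof (intro ballI allI impI)
    fix p q :: "'a \<times> real" and l :: real
    obtain x z y w where pq: "p = (x, z)" "q = (y, w)" by (cases p, cases q)
    assume "p \<in> ?E" "q \<in> ?E" "0 \<le> l \<and> l \<le> 1"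
    then have x: "F a * exp z < F x" and y: "F a * exp w < F y" and "0 \<le> l" "l \<le> 1"
      by (auto simp: pq)
    show "(1 - l) *\<^sub>R p + l *\<^sub>R q \<in> ?E"
    proof (cases "l = 0 \<or> l = 1")
      case False
      then have l: "0 < l" "l < 1" using \<open>0 \<le> l\<close> \<open>l \<le> 1\<close> by auto
      have "0 < F x" "0 < F y" using x y Fa by (smt (verit) exp_gt_zero mult_pos_pos)+
      have "F a * exp ((1 - l) * z + l * w) = (F a * exp z) powr (1 - l) * (F a * exp w) powr l"
        using Fa by (simp add: powr_mult exp_powr_real exp_add mult_ac)
          (simp add: mult.assoc [symmetric] flip: powr_add)
      also have "\<dots> < F x powr (1 - l) * F y powr l"
        using x y l Fa \<open>0 < F x\<close> \<open>0 < F y\<close>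
        by (intro mult_strict_mono powr_less_mono2) auto
      also have "\<dots> \<le> F ((1 - l) *\<^sub>R x + l *\<^sub>R y)" using F l by (rule log_concaveD(2))
      finally show ?thesis by (simp add: pq)
    qed (use x y pq in auto)
  qed
  moreover have "(a, -1) \<in> ?E" "(a, 0) \<notin> ?E" using Fa by simp_all
  then have "?E \<noteq> {}" "?E \<inter> {(a, 0)} = {}" by blast+
  ultimately have "\<exists>g \<beta>. g \<noteq> 0 \<and> (\<forall>x\<in>?E. g \<bullet> x \<le> \<beta>) \<and> (\<forall>x\<in>{(a, 0)}. \<beta> \<le> g \<bullet> x)"
    by (intro separating_hyperplane_sets) simp_all
  then obtain g \<beta> where g: "g \<noteq> 0" "\<forall>x\<in>?E. g \<bullet> x \<le> \<beta>" "\<beta> \<le> g \<bullet> (a, 0)"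
    by blast
  obtain w c where wc: "g = (w, c)" by (cases g)
  have sep: "w \<bullet> (v - a) + c * z \<le> 0" if "F a * exp z < F v" for v z
    using g(2,3) that by (fastforce simp: wc inner_diff_right)
  have "0 \<le> c" using sep [of "-1" a] Fa by simp
  moreover have "c \<noteq> 0"
  proof
    assume "c = 0"
    then have "w \<noteq> 0" using g(1) wc by (auto simp: zero_prod_def)
    \<comment> \<open>A small step from \<open>a\<close> in direction \<open>w\<close> stays in
      \<open>U\<close>, so some point of \<open>?E\<close> lies above it; with \<open>c = 0\<close>
      the separation inequality would fail there.\<close>
    obtain e where e: "0 < e" "ball a e \<subseteq> U" using U(1,2) openE by blast
    let ?v = "a + (e / (2 * norm w)) *\<^sub>R w"
    have "?v \<in> U" using e \<open>w \<noteq> 0\<close> by (intro subsetD [OF e(2)]) (simp add: dist_norm)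
    then have "F a * exp (ln (F ?v / F a) - 1) < F ?v"
      using U(3) [of ?v] Fa by (simp add: exp_diff divide_less_eq)
    from sep [OF this] \<open>c = 0\<close> have "e / (2 * norm w) * (w \<bullet> w) \<le> 0" by simp
    then show False using e(1) \<open>w \<noteq> 0\<close>
      by (metis divide_pos_pos inner_gt_zero_iff mult_pos_pos not_le zero_less_norm_iff zero_less_numeral)
  qed
  ultimately have "0 < c" by simp
  have "F v \<le> F a * exp ((- (1 / c) *\<^sub>R w) \<bullet> (v - a))" for v
  proof (cases "F v = 0")
    case False
    then have Fv: "0 < F v" using log_concaveD(1) [OF F, of v] by simp
    have "ln (F v / F a) \<le> - (w \<bullet> (v - a)) / c"
    proof (rule dense_le)
      fix z assume "z < ln (F v / F a)"
      then have "exp z < F v / F a" using Fv Fa by (metis divide_pos_pos exp_less_mono exp_ln)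
      then have "F a * exp z < F v" using Fa by (simp add: field_simps)
      from sep [OF this] show "z \<le> - (w \<bullet> (v - a)) / c" using \<open>0 < c\<close> by (simp add: field_simps)
    qed
    then have "F v / F a \<le> exp (- (w \<bullet> (v - a)) / c)"
      using Fv Fa by (metis divide_pos_pos exp_le_cancel_iff exp_ln)
    then show ?thesis using Fa by (simp add: field_simps)
  qed (use Fa in simp)
  then show ?thesis by blast
qed

section \<open>Supergradient of the weighted section volume and slicing estimate\<close>

context level_frame begin

text \<open>A product of three log-concave factors: the linear \<open>coord_sum\<close> satisfies
  the weighted AM-GM inequality, and \<open>exp\<close> of it is log-affine. Where the coordinate
  sum is not positive, \<open>V\<close> is 0 and the sign of the power is irrelevant.\<close>

lemma log_concave_weighted_section:
  "log_concave (\<lambda>v. V v * coord_sum v ^ k * exp (coord_sum v))"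
proof -
  have pos: "0 < coord_sum v" if "V v \<noteq> 0" for v
    using section_eq_0 [of v] that by force
  show ?thesis
    unfolding log_concave_def
  proof (intro conjI allI impI)
    fix x :: "real ^ 'n" show "0 \<le> V x * coord_sum x ^ k * exp (coord_sum x)"
      using pos [of x] by (cases "V x = 0") auto
  next
    fix x y :: "real ^ 'n" and l :: real assume l: "0 < l" "l < 1"
    let ?z = "(1 - l) *\<^sub>R x + l *\<^sub>R y" and ?s = coord_sum
    show "(V x * ?s x ^ k * exp (?s x)) powr (1 - l) * (V y * ?s y ^ k * exp (?s y)) powr l
        \<le> V ?z * ?s ?z ^ k * exp (?s ?z)"
    proof (cases "V x = 0 \<or> V y = 0")
      case True
      have "0 \<le> V ?z * ?s ?z ^ k * exp (?s ?z)"
        using pos [of ?z] by (cases "V ?z = 0") auto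
      then show ?thesis using True by auto
    next
      case False
      then have s: "0 < ?s x" "0 < ?s y" using pos by auto
      have "?s x powr (1 - l) * ?s y powr l \<le> ?s ?z"
        using Youngs_inequality_0 [of "1 - l" l "?s x" "?s y"] l s by simp
      then have "(?s x powr (1 - l) * ?s y powr l) ^ k \<le> ?s ?z ^ k"
        by (intro power_mono) auto
      moreover have "(?s x powr (1 - l) * ?s y powr l) ^ k = (?s x ^ k) powr (1 - l) * (?s y ^ k) powr l"
        using s by (simp add: power_mult_distrib powr_powr mult.commute flip: powr_realpow)
      ultimately have "(V x powr (1 - l) * V y powr l) * ((?s x ^ k) powr (1 - l) * (?s y ^ k) powr l)
          \<le> V ?z * ?s ?z ^ k"
        using log_concaveD(2) [OF log_concave_section l, of x y] by (intro mult_mono) auto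
      moreover have "exp (?s x) powr (1 - l) * exp (?s y) powr l = exp (?s ?z)"
        by (simp add: exp_powr_real exp_add mult.commute)
      moreover have "(V x * ?s x ^ k * exp (?s x)) powr (1 - l) * (V y * ?s y ^ k * exp (?s y)) powr l
          = (V x powr (1 - l) * V y powr l) * ((?s x ^ k) powr (1 - l) * (?s y ^ k) powr l)
            * (exp (?s x) powr (1 - l) * exp (?s y) powr l)"
        using s by (simp add: powr_mult)
      ultimately show ?thesis by simp
    qed
  qed
qed

text \<open>Applies \<open>log_concave_supergradient\<close> to the weighted volume. The weight
  \<open>exp (coord_sum v)\<close> forces the coordinates of \<open>u\<close> up to at least 1; the
  weight \<open>coord_sum v ^ k\<close> will cancel the volume growth of
  \<open>k\<close>-dimensional balls. The weighted volume is constant along the frame, so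
  \<open>u\<close> is orthogonal to it.\<close>

lemma section_supergradient:
  assumes "a \<in> orthant" "coord_sum a = 1"
  shows "\<exists>u. (\<forall>i. 1 \<le> u $ i) \<and> (\<forall>i<m. b i \<bullet> u = 0) \<and>
    (\<forall>v. V v * coord_sum v ^ k * exp (coord_sum v) \<le> V a * exp 1 * exp (u \<bullet> (v - a)))"
proof -
  define G where "G v = V v * coord_sum v ^ k * exp (coord_sum v)" for v
  have "0 < G x" if "x \<in> orthant" for x
    using section_pos [OF that] coord_sum_orthant_pos [OF that] by (simp add: G_def)
  then obtain u where u: "G v \<le> G a * exp (u \<bullet> (v - a))" for v
    using log_concave_supergradient [OF _ open_orthant assms(1), of G]
      log_concave_weighted_section [of k] unfolding G_def [abs_def] by blast
  have Ga: "G a = V a * exp 1" using assms(2) by (simp add: G_def)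
  then have "0 < G a" using section_pos [OF assms(1)] by simp
  have "1 \<le> u $ i" for i
  proof -
    \<comment> \<open>From \<open>a\<close> to \<open>a + axis i 1\<close> the coordinate sum rises
      from 1 to 2 and \<open>V\<close> does not decrease, so \<open>G\<close> grows at least by the
      factor \<open>exp 1\<close>, while the supergradient allows at most
      \<open>exp (u $ i)\<close>.\<close>
    have "V a \<le> V (a + axis i 1)" by (rule section_mono) (simp add: axis_def)
    moreover have "1 \<le> (2 :: real) ^ k" by simp
    ultimately have "V a * 1 * exp 2 \<le> V (a + axis i 1) * 2 ^ k * exp 2"
      by (intro mult_right_mono mult_mono) auto
    also have "\<dots> = G (a + axis i 1)" using assms(2) by (simp add: G_def)
    also have "\<dots> \<le> V a * exp 1 * exp (u $ i)" using u [of "a + axis i 1"] Ga by (simp add: inner_axis)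
    also have "\<dots> = V a * exp (1 + u $ i)" by (simp add: exp_add)
    finally have "exp 2 \<le> exp (1 + u $ i)" using section_pos [OF assms(1)] by simp
    then show ?thesis by simp
  qed
  moreover have "b i \<bullet> u = 0" if "i < m" for i
  proof -
    have "G (a + c *\<^sub>R b i) = G a" for c
      using section_translate [of "c *\<^sub>R b i" a] level [OF that] that
      by (simp add: G_def coord_sum_inner inner_add_left span_base span_scale)
    then have "1 \<le> exp (c * (b i \<bullet> u))" for c
      using u [of "a + c *\<^sub>R b i"] \<open>0 < G a\<close> by (simp add: inner_commute)
    from this [of 1] this [of "-1"] show ?thesis by simp
  qed
  ultimately show ?thesis using u Ga unfolding G_def by metis
qed

text \<open>Integrates \<open>exp (- (u \<bullet> x))\<close> over the orthant in nested slices: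
  along \<open>b\<close>, along \<open>k\<close> further directions orthogonal to the all-ones
  vector, and along the diagonal. At diagonal parameter \<open>t\<close> only a
  \<open>k\<close>-ball of radius \<open>?r * t\<close> contributes in the middle
  directions.\<close>

lemma section_lower_bound_aux:
  assumes mk: "Suc (m + k) = CARD('n)"
    and u: "\<And>i. 1 \<le> u $ i" "\<And>i. i < m \<Longrightarrow> b i \<bullet> u = 0"
      "\<And>v. V v * coord_sum v ^ k * exp (coord_sum v) \<le> C * exp (u \<bullet> v)"
    and C: "0 \<le> C"
  shows "1 / (\<Prod>i\<in>UNIV. u $ i) \<le> C * unit_ball_vol (real k) / sqrt (real CARD('n))"
proof -
  let ?r = "sqrt (real CARD('n))" and ?n = "unit_diagonal :: real ^ 'n"
  have "?r > 0" by simp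
  obtain c where c: "orthonormal_frame (m + k) c" "\<forall>i<m. c i = b i" "\<forall>i<m + k. c i \<bullet> 1 = 0"
    using ex_orthonormal_extension [OF frame level, of "m + k"] mk by auto
  define c' where "c' i = c (m + i)" for i
  have c': "orthonormal_frame k c'" "\<And>i. i < k \<Longrightarrow> c' i \<bullet> 1 = 0"
    using c by (auto simp: c'_def orthonormal_frame_def)
  define B where "B = c(m + k := ?n)"
  have B: "orthonormal_frame (Suc (m + k)) B"
    unfolding B_def using c by (intro orthonormal_frame_extend) (simp_all add: coord_sum_inner)
  define H where "H p = exp (- (u \<bullet> p)) * V p" for p
  have H_slice: "slice_integral m c (orthant_exp u) p = ennreal (H p)" for p
    using slice_integral_cong [of m c b] c(2) u(2)
    by (simp add: H_def slice_integral_orthant_exp)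
  \<comment> \<open>The hypothesis on \<open>u\<close> and \<open>V\<close>, solved for
    \<open>H\<close> at points with coordinate sum \<open>?r * t\<close>.\<close>
  define K where "K t = C / (?r * t) ^ k * exp (- (?r * t))" for t
  have H_le: "ennreal (H (frame_map k (t *\<^sub>R ?n) c' w))
      \<le> indicator {0<..} t * ennreal (K t) * indicator (cball 0 (?r * t)) (frame_map k 0 c' w)"
    for t w
  proof (cases "V (frame_map k (t *\<^sub>R ?n) c' w) = 0")
    case False
    let ?p = "frame_map k (t *\<^sub>R ?n) c' w" and ?y = "frame_map k 0 c' w"
    have py: "?p = t *\<^sub>R ?n + ?y" by (simp add: frame_map_def)
    have s: "coord_sum ?p = ?r * t" "coord_sum ?y = 0"
      using c'(2) by (simp_all add: coord_sum_frame_map mult.commute) (simp add: coord_sum_inner)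
    then have t: "0 < ?r * t" using section_eq_0 [of ?p] False by force
    then have "0 < t" using \<open>?r > 0\<close> by (simp add: zero_less_mult_iff)
    have "slice_integral m b (indicator orthant) ?p \<noteq> 0"
      using False by (auto simp: orthant_section_def)
    then obtain x where x: "x \<in> orthant" "x - ?p \<in> span (b ` {..<m})"
      by (rule slice_integral_nonzero)
    have csx: "coord_sum x = ?r * t"
      using coord_sum_span [OF level x(2)] s(1) by simp
    have cb: "c ` {..<m} = b ` {..<m}" using c(2) by (intro image_cong) auto
    \<comment> \<open>Thus \<open>?y\<close> is the orthogonal projection of \<open>x\<close> to the
      span of \<open>c'\<close>, and its norm is at most \<open>norm x\<close>, hence at most the
      coordinate sum of \<open>x\<close>.\<close>
    have "(x - ?p) \<bullet> c (m + i) = 0" if "i < k" for i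
      using orthonormal_frame_span_inner [OF c(1), of m "m + i"] x(2) that cb by simp
    then have "(x - ?p) \<bullet> ?y = 0"
      by (simp add: frame_map_def c'_def inner_sum_right)
    then have "x \<bullet> ?y = ?y \<bullet> ?y"
      using s(2) by (simp add: py inner_diff_left inner_add_left inner_commute [of ?n])
    then have "norm ?y * norm ?y \<le> norm x * norm ?y"
      by (metis norm_cauchy_schwarz power2_eq_square power2_norm_eq_inner)
    then have "norm ?y \<le> norm x" by (metis mult_right_le_imp_le norm_ge_zero norm_le_zero_iff norm_zero order_le_less)
    also have "\<dots> \<le> ?r * t" using norm_le_coord_sum [OF x(1)] csx by simp
    finally have y: "?y \<in> cball 0 (?r * t)" by simp
    define T where "T = ?r * t"
    have "V ?p * T ^ k * exp T \<le> C * exp (u \<bullet> ?p)"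
      using u(3) [of ?p] s unfolding T_def by metis
    moreover have "0 < T" using t by (simp add: T_def)
    ultimately have "H ?p \<le> K t"
      unfolding H_def K_def T_def [symmetric] by (simp add: exp_minus field_simps)
    then show ?thesis using y \<open>0 < t\<close> by (simp add: ennreal_leI)
  qed (simp add: H_def)
  have "ennreal (1 / (\<Prod>i\<in>UNIV. u $ i)) = slice_integral (Suc (m + k)) B (orthant_exp u) 0"
    using slice_integral_full [of "orthant_exp u" B 0] B u(1)
    by (subst nn_integral_orthant_exp [symmetric]) (auto simp: mk intro: less_le_trans [OF zero_less_one])
  also have "\<dots> = (\<integral>\<^sup>+ t. slice_integral (m + k) c (orthant_exp u) (t *\<^sub>R ?n) \<partial>lborel)"
    using slice_integral_cong [of "m + k" B c] by (simp add: slice_integral_Suc B_def)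
  also have "\<dots> = (\<integral>\<^sup>+ t. slice_integral k c' (\<lambda>p. ennreal (H p)) (t *\<^sub>R ?n) \<partial>lborel)"
    by (simp add: slice_integral_add c'_def [abs_def] H_slice [abs_def])
  also have "\<dots> \<le> (\<integral>\<^sup>+ t. ennreal (C * unit_ball_vol (real k))
      * (indicator {0<..} t * ennreal ((?r * t) ^ 0 * exp (- (?r * t)))) \<partial>lborel)"
  proof (intro nn_integral_mono)
    fix t
    have "slice_integral k c' (\<lambda>p. ennreal (H p)) (t *\<^sub>R ?n)
        \<le> (\<integral>\<^sup>+ w. indicator {0<..} t * ennreal (K t) * indicator (cball 0 (?r * t)) (frame_map k 0 c' w)
            \<partial>Pi\<^sub>M {..<k} (\<lambda>_. lborel))"
      unfolding slice_integral_def by (intro nn_integral_mono H_le)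
    also have "\<dots> = indicator {0<..} t * ennreal (K t) * slice_integral k c' (indicator (cball 0 (?r * t))) 0"
    proof -
      have [measurable]: "(indicator (cball 0 (?r * t)) :: real ^ 'n \<Rightarrow> ennreal) \<in> borel_measurable borel"
        by (rule borel_measurable_indicator) simp
      show ?thesis unfolding slice_integral_def by (rule nn_integral_cmult) measurable
    qed
    also have "\<dots> \<le> ennreal (C * unit_ball_vol (real k))
      * (indicator {0<..} t * ennreal ((?r * t) ^ 0 * exp (- (?r * t))))"
    proof (cases "0 < t")
      case True
      \<comment> \<open>The ball volume cancels the power in \<open>K t\<close>, leaving a pure
        exponential with integral \<open>1 / ?r\<close>.\<close>
      then have "K t * (unit_ball_vol (real k) * (?r * t) ^ k)
          = C * unit_ball_vol (real k) * exp (- (?r * t))"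
        by (simp add: K_def)
      then have "ennreal (K t) * ennreal (unit_ball_vol (real k) * (?r * t) ^ k)
          = ennreal (C * unit_ball_vol (real k)) * ennreal (exp (- (?r * t)))"
        using True C by (simp add: K_def flip: ennreal_mult')
      then show ?thesis
        using True slice_integral_indicator_cball [OF c'(1), of "?r * t"] by simp
    qed simp
    finally show "slice_integral k c' (\<lambda>p. ennreal (H p)) (t *\<^sub>R ?n) \<le> \<dots>" .
  qed
  also have "\<dots> = ennreal (C * unit_ball_vol (real k) * (1 / ?r))"
    using nn_integral_power_exp [OF \<open>?r > 0\<close>, of 0] C
    by (subst nn_integral_cmult) (auto simp flip: ennreal_mult')
  finally show ?thesis using C by simp
qed

text \<open>The inequality \<open>t \<le> exp (t - 1)\<close> at \<open>t = u $ i * a $ i\<close>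
  bounds the product of all these numbers by \<open>exp (u \<bullet> a - d)\<close>. Together with
  the factor \<open>exp (1 - u \<bullet> a)\<close> in \<open>C\<close> the unknown \<open>u\<close>
  disappears and \<open>exp (1 - d)\<close> remains.\<close>

lemma section_lower_bound:
  assumes mk: "Suc (m + k) = CARD('n)" and a: "a \<in> orthant" "coord_sum a = 1"
  shows "exp (log_sum a) * exp (real CARD('n) - 1) * sqrt (real CARD('n)) / unit_ball_vol (real k) \<le> V a"
proof -
  let ?d = "real CARD('n)"
  obtain u where u: "\<forall>i. 1 \<le> u $ i" "\<forall>i<m. b i \<bullet> u = 0"
    "\<forall>v. V v * coord_sum v ^ k * exp (coord_sum v) \<le> V a * exp 1 * exp (u \<bullet> (v - a))"
    using section_supergradient [OF a, of k] by blast
  have upos: "0 < u $ i" for i using u(1) by (meson less_le_trans zero_less_one)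
  have apos: "0 < a $ i" for i using a(1) by (simp add: orthant_def)
  define C where "C = V a * exp (1 - u \<bullet> a)"
  have "0 \<le> C" by (simp add: C_def)
  have "V a * exp 1 * exp (u \<bullet> (v - a)) = C * exp (u \<bullet> v)" for v
    by (simp add: C_def inner_diff_right exp_diff)
  then have main: "1 / (\<Prod>i\<in>UNIV. u $ i) \<le> C * unit_ball_vol (real k) / sqrt ?d"
    using u by (intro section_lower_bound_aux [OF mk _ _ _ \<open>0 \<le> C\<close>]) auto
  have "(\<Prod>i\<in>UNIV. u $ i * a $ i) \<le> (\<Prod>i\<in>UNIV. exp (u $ i * a $ i - 1))"
  proof (rule prod_mono)
    fix i show "0 \<le> u $ i * a $ i \<and> u $ i * a $ i \<le> exp (u $ i * a $ i - 1)"
      using upos [of i] apos [of i] exp_ge_add_one_self [of "u $ i * a $ i - 1"] by simp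
  qed
  also have "\<dots> = exp (u \<bullet> a - ?d)"
    by (simp add: inner_vec_def sum_subtractf flip: exp_sum)
  finally have "(\<Prod>i\<in>UNIV. u $ i) * (\<Prod>i\<in>UNIV. a $ i) \<le> exp (u \<bullet> a - ?d)"
    by (simp add: prod.distrib)
  moreover have ea: "exp (log_sum a) = (\<Prod>i\<in>UNIV. a $ i)"
    using apos by (simp add: log_sum_def exp_sum)
  moreover have U: "0 < (\<Prod>i\<in>UNIV. u $ i)" using upos by (intro prod_pos) auto
  ultimately have "exp (log_sum a) \<le> exp (u \<bullet> a - ?d) * (1 / (\<Prod>i\<in>UNIV. u $ i))"
    by (simp add: field_simps)
  also have "\<dots> \<le> exp (u \<bullet> a - ?d) * (C * unit_ball_vol (real k) / sqrt ?d)"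
    by (intro mult_left_mono main) auto
  also have "\<dots> = V a * unit_ball_vol (real k) / (exp (?d - 1) * sqrt ?d)"
    by (simp add: C_def exp_diff field_simps)
  finally show ?thesis by (simp add: field_simps)
qed

end

section \<open>The upper bound\<close>

text \<open>For an orthonormal frame, the component of \<open>w\<close> orthogonal to its span; its
  norm is the distance from \<open>w\<close> to the span.\<close>

definition frame_residual :: "nat \<Rightarrow> (nat \<Rightarrow> 'a::euclidean_space) \<Rightarrow> 'a \<Rightarrow> 'a" where
  "frame_residual m b w = w - (\<Sum>j<m. (w \<bullet> b j) *\<^sub>R b j)"

lemma frame_residual_inner:
  assumes "orthonormal_frame m b" "i < m"
  shows "b i \<bullet> frame_residual m b w = 0"
proof -
  have "b i \<bullet> frame_residual m b w = w \<bullet> b i - (\<Sum>j<m. (w \<bullet> b j) * (b i \<bullet> b j))"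
    by (simp add: frame_residual_def inner_diff_right inner_sum_right inner_commute)
  also have "(\<Sum>j<m. (w \<bullet> b j) * (b i \<bullet> b j)) = (\<Sum>j<m. if j = i then w \<bullet> b i else 0)"
    using assms by (intro sum.cong) (auto simp: orthonormal_frame_def)
  finally show ?thesis using assms(2) by simp
qed

lemma norm_frame_residual:
  assumes "orthonormal_frame m b"
  shows "(norm (frame_residual m b w))\<^sup>2 = w \<bullet> w - (\<Sum>j<m. (w \<bullet> b j)\<^sup>2)"
proof -
  let ?r = "frame_residual m b w"
  have "?r \<bullet> (\<Sum>j<m. (w \<bullet> b j) *\<^sub>R b j) = (\<Sum>j<m. (w \<bullet> b j) * (b j \<bullet> ?r))"
    by (simp add: inner_sum_right inner_commute)
  also have "\<dots> = 0" using frame_residual_inner [OF assms] by simp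
  finally have "?r \<bullet> ?r = ?r \<bullet> w"
    by (simp add: frame_residual_def inner_diff_right)
  also have "\<dots> = w \<bullet> w - (\<Sum>j<m. (w \<bullet> b j)\<^sup>2)"
    unfolding frame_residual_def inner_diff_left inner_sum_left
    by (simp add: power2_eq_square inner_commute [of "b _" w])
  finally show ?thesis by (simp add: power2_norm_eq_inner)
qed

text \<open>The squared distances from the basis vectors to an \<open>m\<close>-dimensional subspace add up to the
  codimension.\<close>

lemma ex_axis_far_from_frame:
  fixes b :: "nat \<Rightarrow> real ^ 'n"
  assumes "orthonormal_frame m b" "m + c = CARD('n)"
  shows "\<exists>i. sqrt (real c / real CARD('n)) \<le> norm (frame_residual m b (axis i 1))"
proof (rule ccontr)
  let ?r = "\<lambda>i. norm (frame_residual m b (axis i 1))"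
  assume "\<not> ?thesis"
  then have less: "?r i < sqrt (real c / real CARD('n))" for i by (simp add: not_le)
  have "(?r i)\<^sup>2 < real c / real CARD('n)" for i
    using power_strict_mono [OF less [of i], of 2] by simp
  then have "(\<Sum>i\<in>UNIV. (?r i)\<^sup>2) < (\<Sum>i\<in>(UNIV :: 'n set). real c / real CARD('n))"
    by (intro sum_strict_mono) auto
  also have "\<dots> = real c" by simp
  finally have "(\<Sum>i\<in>UNIV. (?r i)\<^sup>2) < real c" .
  moreover have "(\<Sum>i\<in>UNIV. (?r i)\<^sup>2) = (\<Sum>i\<in>UNIV. 1 - (\<Sum>j<m. (b j $ i)\<^sup>2))"
    by (simp add: norm_frame_residual [OF assms(1)] inner_axis inner_axis')
  moreover have "(\<Sum>i\<in>UNIV. \<Sum>j<m. (b j $ i)\<^sup>2) = (\<Sum>j<m. b j \<bullet> b j)"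
    by (subst sum.swap) (simp add: inner_vec_def power2_eq_square)
  moreover have "(\<Sum>j<m. b j \<bullet> b j) = real m"
    using assms(1) by (simp add: orthonormal_frame_def)
  ultimately show False using assms(2) by (simp add: sum_subtractf flip: of_nat_add)
qed

text \<open>Shifting by \<open>t *\<^sub>R w\<close> keeps the orthant inside itself and costs the
  factor \<open>exp (- (u \<bullet> w) * t)\<close>, whose integral over \<open>t > 0\<close> is
  \<open>1 / (u \<bullet> w)\<close>. Such a shift advances by \<open>\<delta> * t\<close> in the
  new unit direction \<open>z\<close>, where \<open>\<delta> \<ge> \<eta>\<close> is the distance of
  \<open>w\<close> from the span.\<close>

lemma slice_integral_extend:
  fixes b :: "nat \<Rightarrow> real ^ 'n"
  assumes b: "orthonormal_frame m b" and w: "\<And>i. 0 \<le> w $ i" and uw: "0 < u \<bullet> w"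
    and \<eta>: "0 < \<eta>" "\<eta> \<le> norm (frame_residual m b w)"
  shows "\<exists>c. orthonormal_frame (Suc m) c \<and>
    ennreal (\<eta> / (u \<bullet> w)) * slice_integral m b (orthant_exp u) p
      \<le> slice_integral (Suc m) c (orthant_exp u) p"
proof -
  let ?r = "frame_residual m b w" and ?I = "slice_integral m b (orthant_exp u)"
  define \<delta> where "\<delta> = norm ?r"
  have "0 < \<delta>" "?r \<noteq> 0" using \<eta> by (auto simp: \<delta>_def)
  define z where "z = ?r /\<^sub>R \<delta>"
  define c where "c = b(m := z)"
  have c: "orthonormal_frame (Suc m) c"
    unfolding c_def using b frame_residual_inner [OF b] \<open>?r \<noteq> 0\<close>
    by (intro orthonormal_frame_extend) (auto simp: z_def \<delta>_def)
  have "w - ?r \<in> span (b ` {..<m})"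
    by (auto simp: frame_residual_def intro!: span_sum span_scale intro: span_base)
  then have q: "- (t *\<^sub>R (w - \<delta> *\<^sub>R z)) \<in> span (b ` {..<m})" for t
    using \<open>0 < \<delta>\<close> by (intro span_neg span_scale) (simp add: z_def)
  \<comment> \<open>The vectors \<open>w\<close> and \<open>\<delta> *\<^sub>R z\<close> differ by
    an element of the old span.\<close>
  have shift: "?I (p + (0 + \<delta> * t) *\<^sub>R z) = ?I (p + t *\<^sub>R w)" for t
    using slice_integral_translate [OF orthant_exp_measurable q [of t], of u "p + t *\<^sub>R w"]
    by (simp add: algebra_simps)
  have decay: "ennreal (exp (- ((u \<bullet> w) * t))) * ?I p \<le> ?I (p + t *\<^sub>R w)" if "0 \<le> t" for t
  proof -
    have pt: "ennreal (exp (- ((u \<bullet> w) * t))) * orthant_exp u x \<le> orthant_exp u (x + t *\<^sub>R w)" for x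
    proof (cases "x \<in> orthant")
      case True
      then have "x + t *\<^sub>R w \<in> orthant"
        using w that by (auto simp: orthant_def intro!: add_pos_nonneg)
      then show ?thesis
        using True by (simp add: orthant_exp_def inner_add_right exp_add mult.commute flip: ennreal_mult')
          (simp add: mult.commute flip: exp_add)
    qed (simp add: orthant_exp_def)
    have "ennreal (exp (- ((u \<bullet> w) * t))) * ?I p
        = slice_integral m b (\<lambda>x. ennreal (exp (- ((u \<bullet> w) * t))) * orthant_exp u x) p"
      unfolding slice_integral_def by (rule nn_integral_cmult [symmetric]) measurable
    also have "\<dots> \<le> slice_integral m b (\<lambda>x. orthant_exp u (x + t *\<^sub>R w)) p"
      by (intro slice_integral_mono pt)
    also have "\<dots> = ?I (p + t *\<^sub>R w)"
      by (simp add: slice_integral_def frame_map_def algebra_simps)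
    finally show ?thesis .
  qed
  have "ennreal (\<eta> / (u \<bullet> w)) * ?I p \<le> ennreal (\<delta> / (u \<bullet> w)) * ?I p"
    using \<eta> uw by (intro mult_right_mono ennreal_leI divide_right_mono) (auto simp: \<delta>_def)
  also have "\<dots> = ennreal \<delta> * (\<integral>\<^sup>+ t. ?I p * (indicator {0<..} t * ennreal (((u \<bullet> w) * t) ^ 0 * exp (- ((u \<bullet> w) * t)))) \<partial>lborel)"
    using nn_integral_power_exp [OF uw, of 0] uw \<open>0 < \<delta>\<close>
    by (subst nn_integral_cmult) (auto simp: mult_ac simp flip: mult.assoc ennreal_mult')
  also have "\<dots> \<le> ennreal \<delta> * (\<integral>\<^sup>+ t. ?I (p + (0 + \<delta> * t) *\<^sub>R z) \<partial>lborel)"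
    unfolding shift
  proof (intro mult_left_mono nn_integral_mono)
    fix t show "?I p * (indicator {0<..} t * ennreal (((u \<bullet> w) * t) ^ 0 * exp (- ((u \<bullet> w) * t))))
        \<le> ?I (p + t *\<^sub>R w)"
      using decay [of t] by (cases "0 < t") (simp_all add: mult.commute)
  qed simp
  also have "\<dots> = (\<integral>\<^sup>+ t. ?I (p + t *\<^sub>R z) \<partial>lborel)"
    using \<open>0 < \<delta>\<close> by (subst nn_integral_real_affine [of _ \<delta> 0]) auto
  also have "\<dots> = slice_integral (Suc m) c (orthant_exp u) p"
    using slice_integral_cong [of m c b] by (simp add: slice_integral_Suc c_def)
  finally show ?thesis using c by blast
qed

text \<open>Induction on the codimension. In codimension \<open>k\<close> some coordinate vector has
  distance at least \<open>sqrt (k / d)\<close> from the subspace, and adding it costs at most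
  \<open>M\<close>; the distances multiply to \<open>sqrt (fact k / d ^ k)\<close>.\<close>

lemma slice_integral_le_total:
  fixes b :: "nat \<Rightarrow> real ^ 'n"
  assumes u: "\<And>i. 0 < u $ i" "\<And>i. u $ i \<le> M"
    and b: "orthonormal_frame m b" "m + k = CARD('n)"
  shows "ennreal (sqrt (fact k / real CARD('n) ^ k) / M ^ k) * slice_integral m b (orthant_exp u) p
    \<le> (\<integral>\<^sup>+ x. orthant_exp u x \<partial>lborel)"
  using b
proof (induction k arbitrary: m b)
  case 0
  then show ?case using slice_integral_full [of "orthant_exp u" b p] by simp
next
  case (Suc k)
  let ?d = "real CARD('n)"
  have "0 < M" using u less_le_trans by blast
  obtain i where i: "sqrt (real (Suc k) / ?d) \<le> norm (frame_residual m b (axis i 1))"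
    using ex_axis_far_from_frame Suc.prems by blast
  have axis_nonneg: "0 \<le> axis i (1 :: real) $ j" for j by (simp add: axis_def)
  define \<eta> where "\<eta> = sqrt (real (Suc k) / ?d)"
  have \<eta>: "0 < \<eta>" by (simp add: \<eta>_def)
  obtain c where c: "orthonormal_frame (Suc m) c"
    "ennreal (\<eta> / (u $ i)) * slice_integral m b (orthant_exp u) p
      \<le> slice_integral (Suc m) c (orthant_exp u) p"
    using slice_integral_extend [OF Suc.prems(1) axis_nonneg _ \<eta>, of u p] i u(1) [of i]
    by (auto simp: \<eta>_def inner_axis)
  have "fact (Suc k) / ?d ^ Suc k = (fact k / ?d ^ k) * (real (Suc k) / ?d)"
    by (simp add: mult.commute)
  then have split: "sqrt (fact (Suc k) / ?d ^ Suc k) / M ^ Suc k = (sqrt (fact k / ?d ^ k) / M ^ k) * (\<eta> / M)"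
    unfolding \<eta>_def by (simp only: real_sqrt_mult) simp
  have "0 \<le> \<eta> / M" using \<open>0 < M\<close> \<eta> by simp
  have "ennreal (sqrt (fact (Suc k) / ?d ^ Suc k) / M ^ Suc k) * slice_integral m b (orthant_exp u) p
      = ennreal (sqrt (fact k / ?d ^ k) / M ^ k) * (ennreal (\<eta> / M) * slice_integral m b (orthant_exp u) p)"
    by (simp only: split ennreal_mult'' [OF \<open>0 \<le> \<eta> / M\<close>] mult.assoc)
  also have "\<dots> \<le> ennreal (sqrt (fact k / ?d ^ k) / M ^ k) * (ennreal (\<eta> / (u $ i)) * slice_integral m b (orthant_exp u) p)"
    using u \<eta> \<open>0 < M\<close> by (intro mult_left_mono mult_right_mono ennreal_leI frac_le) auto
  also have "\<dots> \<le> ennreal (sqrt (fact k / ?d ^ k) / M ^ k) * slice_integral (Suc m) c (orthant_exp u) p"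
    by (intro mult_left_mono c(2)) simp
  also have "\<dots> \<le> (\<integral>\<^sup>+ x. orthant_exp u x \<partial>lborel)"
    using Suc.prems by (intro Suc.IH c(1)) simp
  finally show ?case .
qed

context level_frame begin

text \<open>For \<open>u = (1 / a $ i)\<close> criticality gives orthogonality to the frame, so the
  slice integral is \<open>exp (- d) * V a\<close>. The first added direction is \<open>a\<close>
  itself, with \<open>u \<bullet> a = d\<close>; thus only the \<open>k\<close> remaining steps,
  along coordinate vectors, cost a factor \<open>M\<close> each.\<close>

lemma section_upper_bound:
  assumes mk: "Suc (m + k) = CARD('n)" and a: "a \<in> orthant" "coord_sum a = 1"
    and crit: "\<And>j. j < m \<Longrightarrow> (\<Sum>i\<in>UNIV. b j $ i / a $ i) = 0"
    and M: "\<And>i. 1 / a $ i \<le> M"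
  shows "V a * (sqrt (fact k / real CARD('n) ^ k) / M ^ k)
    \<le> exp (log_sum a) * exp (real CARD('n)) * real CARD('n) * sqrt (real CARD('n))"
proof -
  let ?d = "real CARD('n)"
  define u where "u = (\<chi> i. 1 / a $ i)"
  have apos: "0 < a $ i" for i using a(1) by (simp add: orthant_def)
  have "0 < M" using less_le_trans [OF _ M] apos by (metis zero_less_divide_1_iff)
  have ua: "u \<bullet> a = ?d"
  proof -
    have "u \<bullet> a = (\<Sum>i\<in>(UNIV :: 'n set). 1)"
      unfolding inner_vec_def by (intro sum.cong) (use apos in \<open>auto simp: u_def less_imp_neq [THEN not_sym]\<close>)
    then show ?thesis by simp
  qed
  have bu: "b j \<bullet> u = 0" if "j < m" for j using crit [OF that] by (simp add: u_def inner_vec_def)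
  \<comment> \<open>The frame is orthogonal to the diagonal, so the residual keeps the diagonal
    component \<open>1 / sqrt ?d\<close> of \<open>a\<close>.\<close>
  have "1 / sqrt ?d \<le> norm (frame_residual m b a)"
  proof -
    have "(\<Sum>j<m. (a \<bullet> b j) *\<^sub>R b j) \<bullet> unit_diagonal = 0"
      using level by (simp add: inner_sum_left coord_sum_inner)
    then have "frame_residual m b a \<bullet> unit_diagonal = 1 / sqrt ?d"
      using a(2) by (simp add: frame_residual_def inner_diff_left del: unit_diagonal(3))
        (simp add: unit_diagonal(3))
    then show ?thesis
      using norm_cauchy_schwarz [of "frame_residual m b a" unit_diagonal] by simp
  qed
  then obtain c where c: "orthonormal_frame (Suc m) c"
    "ennreal (1 / sqrt ?d / ?d) * slice_integral m b (orthant_exp u) a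
      \<le> slice_integral (Suc m) c (orthant_exp u) a"
    using slice_integral_extend [OF frame, of a u "1 / sqrt ?d" a] apos by (auto simp: ua less_imp_le)
  let ?K = "sqrt (fact k / ?d ^ k) / M ^ k"
  have "ennreal (?K * (1 / sqrt ?d / ?d) * (exp (- ?d) * V a))
      = ennreal ?K * (ennreal (1 / sqrt ?d / ?d) * slice_integral m b (orthant_exp u) a)"
    using \<open>0 < M\<close> bu by (simp add: slice_integral_orthant_exp ua mult.assoc flip: ennreal_mult')
  also have "\<dots> \<le> ennreal ?K * slice_integral (Suc m) c (orthant_exp u) a"
    by (intro mult_left_mono c(2)) simp
  also have "\<dots> \<le> (\<integral>\<^sup>+ x. orthant_exp u x \<partial>lborel)"
    using mk M by (intro slice_integral_le_total c(1)) (auto simp: u_def apos)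
  also have "\<dots> = ennreal (1 / (\<Prod>i\<in>UNIV. u $ i))"
    by (rule nn_integral_orthant_exp) (simp add: u_def apos)
  also have "1 / (\<Prod>i\<in>UNIV. u $ i) = exp (log_sum a)"
    using apos by (simp add: u_def log_sum_def exp_sum prod_dividef)
  finally have le: "?K * (1 / sqrt ?d / ?d) * (exp (- ?d) * V a) \<le> exp (log_sum a)"
    by simp
  have arith: "v * K \<le> E * e * D * r"
    if "K * (1 / r / D) * (1 / e * v) \<le> E" "0 < r" "0 < D" "0 < e" for K r D e v E :: real
    using that by (simp add: field_simps)
  show ?thesis
    by (rule arith) (use le in \<open>simp_all add: exp_minus inverse_eq_divide\<close>)
qed

end

text \<open>The orthant is open, so \<open>t = 0\<close> is an interior local maximum along the line
  and the derivative vanishes there.\<close>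

lemma log_sum_critical:
  assumes a: "a \<in> orthant" and max: "\<And>t. a + t *\<^sub>R v \<in> orthant \<Longrightarrow> log_sum (a + t *\<^sub>R v) \<le> log_sum a"
  shows "(\<Sum>i\<in>UNIV. v $ i / a $ i) = 0"
proof -
  have apos: "0 < a $ i" for i using a by (simp add: orthant_def)
  have "((\<lambda>t. \<Sum>i\<in>UNIV. ln (a $ i + t * v $ i)) has_real_derivative (\<Sum>i\<in>UNIV. v $ i / a $ i)) (at 0)"
    using apos by (auto intro!: derivative_eq_intros sum.cong)
  then have D: "((\<lambda>t. log_sum (a + t *\<^sub>R v)) has_real_derivative (\<Sum>i\<in>UNIV. v $ i / a $ i)) (at 0)"
    by (simp add: log_sum_def)
  have "eventually (\<lambda>t. a + t *\<^sub>R v \<in> orthant) (at 0)"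
  proof -
    have "((\<lambda>t. a + t *\<^sub>R v) \<longlongrightarrow> a + 0 *\<^sub>R v) (at 0)" by (intro tendsto_intros)
    then show ?thesis using open_orthant a by (auto dest: topological_tendstoD)
  qed
  then obtain e where e: "0 < e" "\<And>t. t \<noteq> 0 \<Longrightarrow> dist t 0 < e \<Longrightarrow> a + t *\<^sub>R v \<in> orthant"
    unfolding eventually_at by auto
  have "log_sum (a + t *\<^sub>R v) \<le> log_sum (a + 0 *\<^sub>R v)" if "\<bar>0 - t\<bar> < e" for t
    using max [of t] e(2) [of t] that by (cases "t = 0") auto
  then show ?thesis using DERIV_local_max [OF D e(1)] by blast
qed

section \<open>Elementary estimates for the constants\<close>

lemma power_self_le_exp_fact: "real n ^ n \<le> exp (real n) * fact n"
proof -
  have "(\<Sum>i\<in>{n}. inverse (fact i) * real n ^ i) \<le> (\<Sum>i. inverse (fact i) * real n ^ i)"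
    by (intro sum_le_suminf summable_exp) auto
  also have "\<dots> = exp (real n)" by (simp add: exp_def scaleR_conv_of_real)
  finally show ?thesis by (simp add: field_simps)
qed

text \<open>The difference vanishes at 0 and has derivative
  \<open>y\<^sup>2 / ((1 + y) * (2 + y)\<^sup>2)\<close>. At \<open>x = 1 / n\<close> it yields
  \<open>1 \<le> (n + 1 / 2) * ln (1 + 1 / n)\<close>, as needed for Stirling.\<close>

lemma ln_ge_secant:
  fixes x :: real
  assumes "0 \<le> x"
  shows "2 * x / (2 + x) \<le> ln (1 + x)"
proof -
  let ?f = "\<lambda>x :: real. ln (1 + x) - 2 * x / (2 + x)"
  have "?f 0 \<le> ?f x"
  proof (rule DERIV_nonneg_imp_nondecreasing [OF assms])
    fix y :: real assume "0 \<le> y" "y \<le> x"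
    then have "(?f has_real_derivative (1 / (1 + y) - (2 * (2 + y) - 2 * y) / (2 + y)\<^sup>2)) (at y)"
      by (auto intro!: derivative_eq_intros simp: power2_eq_square)
    moreover have "1 / (1 + y) - (2 * (2 + y) - 2 * y) / (2 + y)\<^sup>2 = y\<^sup>2 / ((1 + y) * (2 + y)\<^sup>2)"
    proof -
      have "1 + y \<noteq> 0" "(2 + y)\<^sup>2 \<noteq> 0" using \<open>0 \<le> y\<close> by auto
      moreover have "1 * (2 + y)\<^sup>2 - (2 * (2 + y) - 2 * y) * (1 + y) = y\<^sup>2"
        by (simp add: power2_eq_square algebra_simps)
      ultimately show ?thesis by (metis diff_frac_eq)
    qed
    ultimately have "(?f has_real_derivative (y\<^sup>2 / ((1 + y) * (2 + y)\<^sup>2))) (at y)" by simp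
    moreover have "0 \<le> y\<^sup>2 / ((1 + y) * (2 + y)\<^sup>2)" using \<open>0 \<le> y\<close> by simp
    ultimately show "\<exists>z. (?f has_real_derivative z) (at y) \<and> 0 \<le> z" by blast
  qed
  then show ?thesis by simp
qed

text \<open>Stirling's upper bound: the quotient of \<open>fact n * exp n\<close> by
  \<open>sqrt n * n ^ n\<close> is nonincreasing and equals \<open>exp 1\<close> at
  \<open>n = 1\<close>.\<close>

lemma fact_exp_le:
  assumes "1 \<le> n"
  shows "fact n * exp (real n) \<le> exp 1 * sqrt (real n) * real n ^ n"
  using assms
proof (induction n rule: dec_induct)
  case (step n)
  let ?x = "real n"
  have x: "0 < ?x" using step.hyps by simp
  have "1 \<le> (?x + 1 / 2) * ln (1 + 1 / ?x)"
    using ln_ge_secant [of "1 / ?x"] x by (simp add: field_simps)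
  also have "ln (1 + 1 / ?x) = ln (?x + 1) - ln ?x"
    using ln_div [of "?x + 1" ?x] x by (simp add: add_divide_distrib)
  finally have "1 + ln ?x / 2 + ?x * ln ?x \<le> ln (?x + 1) / 2 + ?x * ln (?x + 1)"
    by (simp add: algebra_simps)
  then have "exp (1 + ln ?x / 2 + ?x * ln ?x) \<le> exp (ln (?x + 1) / 2 + ?x * ln (?x + 1))"
    by simp
  moreover have "exp (ln y / 2) = sqrt y" if "0 < y" for y
    using that by (simp flip: ln_sqrt)
  moreover have "exp (?x * ln y) = y ^ n" if "0 < y" for y
    using that by (simp add: exp_of_nat_mult)
  ultimately have key: "exp 1 * sqrt ?x * ?x ^ n \<le> sqrt (?x + 1) * (?x + 1) ^ n"
    using x by (simp add: exp_add)
  have "fact (Suc n) * exp (real (Suc n)) = (?x + 1) * exp 1 * (fact n * exp ?x)"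
    by (simp add: exp_add algebra_simps)
  also have "\<dots> \<le> (?x + 1) * exp 1 * (exp 1 * sqrt ?x * ?x ^ n)"
    using step.IH by (intro mult_left_mono) auto
  also have "\<dots> \<le> (?x + 1) * exp 1 * (sqrt (?x + 1) * (?x + 1) ^ n)"
    by (intro mult_left_mono key) auto
  finally show ?case by (simp add: algebra_simps)
qed simp

lemma two_power_le_fact: "(2 :: real) ^ n \<le> fact (Suc n)"
proof (induction n)
  case (Suc n)
  have "(2 :: real) ^ Suc n \<le> real (Suc (Suc n)) * fact (Suc n)"
    unfolding power_Suc using Suc by (intro mult_mono) auto
  then show ?case by (simp only: fact_Suc)
qed simp

text \<open>After squaring, with \<open>k = Suc j\<close>, the claim reads
  \<open>1 / fact k \<le> d ^ j / 4 ^ j\<close>; it follows from \<open>2 ^ j \<le> fact k\<close>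
  and \<open>2 ^ j \<le> d ^ j\<close>.\<close>

lemma sqrt_power_fact_le:
  assumes "2 \<le> d" "1 \<le> k"
  shows "sqrt d * sqrt (d ^ k / fact k) \<le> 2 * (d / 2) ^ k"
proof -
  obtain j where k: "k = Suc j" using assms(2) by (cases k) auto
  define P Q K where "P = d ^ j" and "Q = (2 :: real) ^ j * 2 ^ j" and "K = (fact k :: real)"
  have "Q \<le> K * P"
    using two_power_le_fact [of j] assms(1) unfolding k P_def Q_def K_def
    by (intro mult_mono power_mono) auto
  moreover have "0 < Q" "0 < K" "0 < P" using assms(1) by (simp_all add: P_def Q_def K_def)
  ultimately have "1 / K \<le> P / Q" by (simp add: field_simps)
  then have "P * d * d * (1 / K) \<le> P * d * d * (P / Q)"
    using \<open>0 < P\<close> assms(1) by (intro mult_left_mono) auto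
  moreover have "d * (d ^ k / fact k) = P * d * d * (1 / K)"
    by (simp add: k P_def K_def mult_ac)
  moreover have "(2 * (d / 2) ^ k)\<^sup>2 = P * d * d * (P / Q)"
    by (simp add: k P_def Q_def power2_eq_square power_divide mult_ac)
  ultimately have "d * (d ^ k / fact k) \<le> (2 * (d / 2) ^ k)\<^sup>2" by simp
  then have "sqrt (d * (d ^ k / fact k)) \<le> 2 * (d / 2) ^ k"
    using assms(1) by (intro real_le_lsqrt) auto
  then show ?thesis by (simp only: real_sqrt_mult)
qed

section \<open>Volume of the simplex and assembly of both bounds\<close>

lemma frame_line_mem:
  assumes "j < s"
  shows "a + t *\<^sub>R b j \<in> range (frame_map s a b)"
proof
  show "a + t *\<^sub>R b j = frame_map s a b (\<lambda>i. if i = j then t else 0)"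
    using assms by (simp add: frame_map_def if_distrib [of "\<lambda>c. c *\<^sub>R _"] cong: if_cong)
qed simp

text \<open>The case where \<open>L\<close> is the whole hyperplane, with the barycenter as base
  point.\<close>

lemma vol_open_simplex:
  assumes "2 \<le> CARD('n)"
  shows "vol (CARD('n) - 1) (open_simplex :: (real ^ 'n) set) = sqrt (real CARD('n)) / fact (CARD('n) - 1)"
proof -
  let ?d = "CARD('n)" and ?H = "simplex_hyperplane :: (real ^ 'n) set"
  let ?c = "(1 / real ?d) *\<^sub>R (1 :: real ^ 'n)"
  have H: "?H = {x. 1 \<bullet> x = 1}"
    by (auto simp: simplex_hyperplane_eq coord_sum_inner inner_commute)
  have "aff_dim ?H = int (?d - 1)"
    unfolding H by (subst aff_dim_hyperplane) (use assms in auto)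
  moreover have "affine ?H" unfolding H by (rule affine_hyperplane)
  moreover have c: "?c \<in> open_simplex \<inter> ?H"
    by (auto simp: open_simplex_eq simplex_hyperplane_eq orthant_def)
  moreover have "open_simplex \<inter> ?H = open_simplex"
    by (auto simp: open_simplex_def)
  ultimately obtain b where b: "level_frame (?d - 1) b"
    "vol (?d - 1) (open_simplex :: (real ^ 'n) set) = orthant_section (?d - 1) b ?c"
    using simplex_section_vol [of ?H ?c "?d - 1"] by auto
  interpret level_frame "?d - 1" b by (rule b)
  show ?thesis unfolding b(2) using assms by (intro section_simplex) auto
qed

theorem theorem3p1:
  fixes L :: "(real ^ 'n) set" and a :: "real ^ 'n" and k :: nat
  defines "d \<equiv> CARD('n)"
  assumes "d \<ge> 2"
    and "k \<ge> 1"
    and "affine L"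
    and "L \<subseteq> simplex_hyperplane"
    and "open_simplex \<inter> L \<noteq> {}"
    and "aff_dim L = int d - int k - 1"
    and "a \<in> open_simplex \<inter> L"
    and "\<forall>x \<in> open_simplex \<inter> L. log_sum x \<le> log_sum a"
  shows "vol (d - k - 1) (open_simplex \<inter> L) / vol (d - 1) (open_simplex :: (real ^ 'n) set)
           \<ge> 1 / (2 * exp 1 ^ 3) * (1 / (real d ^ 2 * unit_ball_vol (real k)))
              * real d ^ d * exp (log_sum a)
       \<and> (\<forall>\<epsilon>>0. (\<forall>i. a $ i \<ge> \<epsilon> / real d) \<longrightarrow>
           vol (d - k - 1) (open_simplex \<inter> L) / vol (d - 1) (open_simplex :: (real ^ 'n) set)
             \<le> 2 * exp 1 * (real d ^ 2 / (2 * \<epsilon>)) ^ k * real d ^ d * exp (log_sum a))"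
proof -
  define s where "s = d - k - 1"
  let ?D = "real d" and ?F = "exp (log_sum a)" and ?\<omega> = "unit_ball_vol (real k)"
  \<comment> \<open>Nonemptiness gives \<open>k + 1 \<le> d\<close>, so the natural subtraction in
    \<open>s\<close> is exact.\<close>
  have "\<not> aff_dim L < 0" using assms(6) by auto
  then have sk: "Suc (s + k) = d" "aff_dim L = int s" using assms(7) by (auto simp: s_def)
  have D: "0 < ?D" "2 \<le> ?D" using assms(2) by auto
  have a: "a \<in> orthant" "coord_sum a = 1" using assms(8) by (auto simp: open_simplex_eq)
  obtain b where b: "level_frame s b" "L = range (frame_map s a b)"
    "vol s (open_simplex \<inter> L) = orthant_section s b a"
    using simplex_section_vol [OF assms(4,5,8) sk(2)] by blast
  interpret level_frame s b by (rule b)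
  define R where "R = vol s (open_simplex \<inter> L) / vol (d - 1) (open_simplex :: (real ^ 'n) set)"
  have factd: "fact d = ?D * fact (d - 1)" using assms(2) by (simp add: fact_reduce)
  have R: "R = V a * fact d / (?D * sqrt ?D)"
    unfolding R_def b(3) factd using vol_open_simplex [where 'n = 'n] assms(2) D by (simp add: d_def)
  have "1 / (2 * exp 1 ^ 3) * (1 / (?D ^ 2 * ?\<omega>)) * ?D ^ d * ?F \<le> R"
  proof -
    have "1 / (2 * exp 1 ^ 3) * (1 / (?D ^ 2 * ?\<omega>)) * ?D ^ d * ?F
        = (1 / (2 * exp 1 ^ 3 * ?D ^ 2)) * (?D ^ d * ?F / ?\<omega>)"
      by simp
    \<comment> \<open>The argument gives the better factor \<open>1 / (exp 1 * d)\<close>; here it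
      is weakened to the stated constant.\<close>
    also have "\<dots> \<le> (1 / (exp 1 * ?D)) * (?D ^ d * ?F / ?\<omega>)"
    proof (intro mult_right_mono divide_left_mono)
      have e: "1 \<le> (exp 1 :: real)" by simp
      have "1 \<le> 2 * (exp 1 :: real) ^ 2"
        using one_le_power [OF e, of 2] by linarith
      then have "1 * 1 \<le> (2 * exp 1 ^ 2) * ?D"
        using D by (intro mult_mono) auto
      then have "exp 1 * ?D * 1 \<le> exp 1 * ?D * (2 * exp 1 ^ 2 * ?D)"
        using D by (intro mult_left_mono) auto
      then show "exp 1 * ?D \<le> 2 * exp 1 ^ 3 * ?D ^ 2"
        by (simp add: power2_eq_square power3_eq_cube mult_ac)
    qed (use D in auto)
    also have "\<dots> \<le> (1 / (exp 1 * ?D)) * (exp ?D * fact d * ?F / ?\<omega>)"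
      using D power_self_le_exp_fact [of d]
      by (intro mult_left_mono divide_right_mono mult_right_mono) auto
    also have "\<dots> = (?F * exp (?D - 1) * sqrt ?D / ?\<omega>) * fact d / (?D * sqrt ?D)"
      using D by (simp add: exp_diff mult_ac)
    also have "\<dots> \<le> V a * fact d / (?D * sqrt ?D)"
      using section_lower_bound [of k a] sk(1) a
      by (intro divide_right_mono mult_right_mono) (auto simp: d_def)
    finally show ?thesis unfolding R .
  qed
  moreover have "R \<le> 2 * exp 1 * (?D ^ 2 / (2 * \<epsilon>)) ^ k * ?D ^ d * ?F"
    if \<epsilon>: "0 < \<epsilon>" "\<forall>i. a $ i \<ge> \<epsilon> / ?D" for \<epsilon>
  proof -
    \<comment> \<open>The assumption on the coordinates of \<open>a\<close> bounds their reciprocals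
      by this number.\<close>
    define M where "M = ?D / \<epsilon>"
    have "0 < M" using D \<epsilon> by (simp add: M_def)
    have M: "1 / a $ i \<le> M" for i
    proof -
      have "0 < a $ i" using a(1) by (simp add: orthant_def)
      then show ?thesis using \<epsilon>(2) [rule_format, of i] \<epsilon>(1) D by (simp add: M_def field_simps)
    qed
    have crit: "(\<Sum>i\<in>UNIV. b j $ i / a $ i) = 0" if "j < s" for j
    proof (rule log_sum_critical [OF a(1)])
      fix t assume "a + t *\<^sub>R b j \<in> orthant"
      moreover have "a + t *\<^sub>R b j \<in> L" unfolding b(2) by (rule frame_line_mem [OF that])
      ultimately show "log_sum (a + t *\<^sub>R b j) \<le> log_sum a"
        using assms(5,9) by (auto simp: open_simplex_eq simplex_hyperplane_eq)
    qed
    define S where "S = sqrt (?D ^ k / fact k)"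
    have S: "0 < S" "sqrt (fact k / ?D ^ k) = 1 / S"
      using D by (simp_all add: S_def real_sqrt_divide)
    have "V a * (1 / S / M ^ k) \<le> ?F * exp ?D * ?D * sqrt ?D"
      using section_upper_bound [of k a M] sk(1) a crit M by (simp add: d_def [symmetric] S)
    then have "V a \<le> ?F * exp ?D * ?D * sqrt ?D * (S * M ^ k)"
      using S \<open>0 < M\<close> by (simp add: field_simps)
    then have "R \<le> ?F * exp ?D * ?D * sqrt ?D * (S * M ^ k) * fact d / (?D * sqrt ?D)"
      unfolding R by (intro divide_right_mono mult_right_mono) auto
    also have "\<dots> = (fact d * exp ?D) * (?F * S * M ^ k)"
      using D by simp
    \<comment> \<open>Stirling turns \<open>fact d * exp d\<close> into \<open>d ^ d\<close>; the
      leftover \<open>sqrt d * S\<close> is absorbed next into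
      \<open>2 * (d / 2) ^ k\<close>.\<close>
    also have "\<dots> \<le> (exp 1 * sqrt ?D * ?D ^ d) * (?F * S * M ^ k)"
      using assms(2) S \<open>0 < M\<close> by (intro mult_right_mono fact_exp_le) auto
    also have "\<dots> = (sqrt ?D * S) * (exp 1 * ?D ^ d * ?F * M ^ k)"
      by simp
    also have "\<dots> \<le> (2 * (?D / 2) ^ k) * (exp 1 * ?D ^ d * ?F * M ^ k)"
      unfolding S_def using D assms(3) \<open>0 < M\<close>
      by (intro mult_right_mono sqrt_power_fact_le) auto
    also have "\<dots> = 2 * exp 1 * ((?D / 2) * M) ^ k * ?D ^ d * ?F"
      by (simp only: power_mult_distrib mult_ac)
    also have "(?D / 2) * M = ?D ^ 2 / (2 * \<epsilon>)" by (simp add: M_def power2_eq_square)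
    finally show ?thesis .
  qed
  ultimately show ?thesis unfolding R_def s_def by blast
qed

end
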